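(* Let $k$ be a field, $n\ge 1$, and let $X = k[x_1,\ldots,x_n]/I$, where $I=0$ if $\mathrm{char}(k)=0$ and $I=(x_1^p,\ldots,x_n^p)$ if $\mathrm{char}(k)=p>0$. Let $L$ be a Lie algebra over $k$ and let $$\psi : L \to L\wr\mathrm{Der}\,X=(X\otimes L)\rtimes \mathrm{Der}\,X$$ be a Lie algebra homomorphism. Let $\epsilon: X\to k$ be the $k$-algebra map with $\epsilon(x_i)=0$ for $1\le i\le n$, let $H=\mathrm{Ker}(\pi\psi)$ and let $\theta=(\epsilon\otimes \mathrm{id}_L)\psi : H\to L$ be the virtual endomorphism associated to $\psi$ with respect to $\epsilon$. Assume that: 1. $L = H\rtimes L_0$; 2. $L_0$ contains an abelian Lie algebra with $k$-linear basis $y_1,\ldots,y_n$ such that $\psi(y_i)=\partial/\partial x_i$; 3. there is a positive integer $m$ such that $\theta(y_i^m\circ H)=0$ for every $1\le i\le n$, and if $\mathrm{char}(k)=p>0$ then $m=p$. Then: a) for every $h\in H$, $$\psi(h)=\sum_{0\le i_1,\ldots,i_n\le m-1}(i_1!\cdots i_n!)^{-1}\,x_1^{i_1}\cdots x_n^{i_n}\otimes\theta(y_1^{i_1}\cdots y_n^{i_n}\circ h);$$ b) $\psi$ is a monomorphism if and only if $\mathrm{Ker}(\theta)$ does not contain non-trivial (i.e. non-zero) ideals of $L$; c) $L$ is a faithful $\psi$-self-similar Lie algebra if and only if there is no non-trivial (i.e. non-zero) $\theta$-invariant ideal $J$ of $L$ such that $J\subseteq H$, where $\theta$-invariant means $\theta(J)\subseteq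 J$; d) an element $h\in H$ is finite state if there is a finite dimensional subspace $V$ of $H$ such that $h\in V$ and $\theta(y_1^{i_1}\cdots y_n^{i_n}\circ V)\subseteq V$ for every $0\le i_1,\ldots,i_n\le m-1$; e) if $n=1$, $\mathrm{char}(k)=p>0$ and $\theta(H)=L$, then $L$ is a transitive $\psi$-self-similar Lie algebra.
   Context: All tensor products are over $k$. For a commutative $k$-algebra $X$ with $1$ and a Lie $k$-algebra $L$, $\mathrm{Der}\,X$ is the Lie algebra of $k$-derivations of $X$, and $L\wr \mathrm{Der}\,X=(X\otimes L)\rtimes\mathrm{Der}\,X$ is the Lie algebra with brackets $[x_1\otimes a_1,x_2\otimes a_2]=(x_1x_2)\otimes[a_1,a_2]$, $[\delta,x\otimes a]=\delta(x)\otimes a$, and the usual bracket on $\mathrm{Der}\,X$. The map $\pi:(X\otimes L)\rtimes\mathrm{Der}\,X\to\mathrm{Der}\,X$ is the canonical projection; thus $\psi(\mathrm{Ker}(\pi\psi))\subseteq X\otimes L$. $L=H\rtimes L_0$ means that $H$ is an ideal, $L_0$ is a Lie subalgebra, and $L=H\oplus L_0$ as vector spaces. For $b,h\in L$, $b\circ h=[b,h]$; for $\lambda$ in the universal enveloping algebra $U(L)$, $\lambda\circ h$ is the result of the (adjoint) left action of $\lambda$ on $h$; in particular $b^m\circ h=\mathrm{ad}(b)^m(h)$ and $b^0\circ h=h$. Action on tensor powers: if $\psi(a)=\sum_i z_i\otimes a_i+\delta_a$ with $z_i\in X$, $a_i\in L$, $\delta_a\in\mathrm{Der}\,X$, then $a\cdot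 x=\delta_a(x)$ for $x\in X$ and, inductively, $a\cdot(v_1\otimes\cdots\otimes v_m)=\sum_i (z_iv_1)\otimes a_i\cdot(v_2\otimes\cdots\otimes v_m)+\delta_a(v_1)\otimes v_2\otimes\cdots\otimes v_m$. This gives Lie algebra homomorphisms $L\to\mathrm{End}_k(X^{\otimes m})$, $m\ge1$. $L$ is a $\psi$-self-similar Lie algebra if $\psi: L\to L\wr\mathrm{Der}\,X$ is a monomorphism which is proper, in the sense that it does not map $L$ into some Lie subalgebra of $X\otimes L$ or into $\mathrm{Der}\,X$. $L$ is a faithful $\psi$-self-similar Lie algebra if $\psi$ is a monomorphism and, in addition, the induced action of $L$ on the tensor algebra $\bigoplus_{m\ge0}X^{\otimes m}$ is injective, i.e. $\bigcap_{m\ge1}\mathrm{Ker}(L\to\mathrm{End}_k(X^{\otimes m}))=0$. An element $a\in L$ is finite state if there is a finite dimensional subspace $S\subseteq L$ with $a\in S$ and $\psi(S)\subseteq (X\otimes S)\rtimes\mathrm{Der}\,X$. When $X=k[x]/(x^p)$ with $\mathrm{char}(k)=p>0$, a $\psi$-self-similar Lie algebra $L$ is transitive if for every $m\ge1$, $X^{\otimes m}$ is a cyclic left $U(L)$-module with generator $x^{p-1}\otimes\cdots\otimes x^{p-1}$.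
   Formalization: In (e), ψ need not be injective under the stated hypotheses, so "L is a transitive ψ-self-similar Lie algebra" is proved when ψ is a monomorphism; the cyclicity of every tensor power of X over U(L) is proved without that assumption. *)

theory Defs
  imports Complex_Main "HOL-Library.Poly_Mapping" "HOL-Library.Cardinality"
begin

section \<open>Free vector spaces and their quotients\<close>

text \<open>
  The free \<open>'k\<close>-vector space on a type \<open>'w\<close> is \<open>'w \<Rightarrow>\<^sub>0 'k\<close>, with basis
  \<open>Poly_Mapping.single w 1\<close>.  A quotient by a subspace \<open>R\<close> that depends on term-level data (such
  as the scalar multiplication of a Lie algebra) is represented by the set of cosets of \<open>R\<close>.
\<close>

definition pm_scale :: "'k::field \<Rightarrow> ('w \<Rightarrow>\<^sub>0 'k) \<Rightarrow> ('w \<Rightarrow>\<^sub>0 'k)" where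
  "pm_scale c f = Poly_Mapping.map ((*) c) f"

text \<open>The value at \<open>f\<close> of the linear extension of a map \<open>B\<close> defined on the basis.\<close>

definition pm_ext :: "('k::field \<Rightarrow> 'v::ab_group_add \<Rightarrow> 'v) \<Rightarrow> ('w \<Rightarrow> 'v) \<Rightarrow> ('w \<Rightarrow>\<^sub>0 'k) \<Rightarrow> 'v" where
  "pm_ext s B f = (\<Sum>w\<in>Poly_Mapping.keys f. s (Poly_Mapping.lookup f w) (B w))"

definition coset_of :: "'v::ab_group_add set \<Rightarrow> 'v \<Rightarrow> 'v set" where
  "coset_of R f = {g. g - f \<in> R}"

definition coset_rep :: "'v set \<Rightarrow> 'v" where
  "coset_rep t = (SOME f. f \<in> t)"

lemma lookup_pm_scale [simp]:
  "Poly_Mapping.lookup (pm_scale c f) w = c * Poly_Mapping.lookup f w"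
  by (simp add: pm_scale_def Poly_Mapping.map.rep_eq when_def)

lemma vector_space_pm_scale: "vector_space (pm_scale :: 'k::field \<Rightarrow> ('w \<Rightarrow>\<^sub>0 'k) \<Rightarrow> _)"
  by unfold_locales
    (auto intro!: poly_mapping_eqI simp: lookup_add algebra_simps)

interpretation pm: vector_space "pm_scale :: 'k::field \<Rightarrow> ('w \<Rightarrow>\<^sub>0 'k) \<Rightarrow> _"
  by (rule vector_space_pm_scale)

section \<open>The algebra \<open>X\<close>\<close>

text \<open>
  The variables are indexed by the finite type \<open>'n\<close> (so that \<open>n = CARD('n) \<ge> 1\<close>), and
  \<open>('n \<Rightarrow>\<^sub>0 nat) \<Rightarrow>\<^sub>0 'k\<close> is the polynomial ring in these variables.
\<close>

definition pvar :: "'n \<Rightarrow> (('n \<Rightarrow>\<^sub>0 nat) \<Rightarrow>\<^sub>0 'k::field)" where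
  "pvar i = Poly_Mapping.single (Poly_Mapping.single i 1) 1"

definition power_ideal :: "(('n::finite \<Rightarrow>\<^sub>0 nat) \<Rightarrow>\<^sub>0 'k::field) set" where
  "power_ideal = (if CHAR('k) = 0 then {0}
     else range (\<lambda>g :: 'n \<Rightarrow> (('n \<Rightarrow>\<^sub>0 nat) \<Rightarrow>\<^sub>0 'k). \<Sum>i\<in>UNIV. g i * pvar i ^ CHAR('k)))"

lift_definition ppderiv :: "'n \<Rightarrow> (('n \<Rightarrow>\<^sub>0 nat) \<Rightarrow>\<^sub>0 'k::field) \<Rightarrow> (('n \<Rightarrow>\<^sub>0 nat) \<Rightarrow>\<^sub>0 'k)"
  is "\<lambda>i f a. of_nat (Poly_Mapping.lookup a i + 1) * f (a + Poly_Mapping.single i 1)"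
proof -
  fix i :: 'n and f :: "('n \<Rightarrow>\<^sub>0 nat) \<Rightarrow> 'k"
  let ?s = "\<lambda>a. a + Poly_Mapping.single i (1::nat)"
  assume "finite {a. f a \<noteq> 0}"
  then have "finite (?s -` {a. f a \<noteq> 0})"
    by (rule finite_vimageI) (simp add: inj_def)
  then show "finite {a. of_nat (Poly_Mapping.lookup a i + 1) * f (?s a) \<noteq> 0}"
    by (rule rev_finite_subset) auto
qed

lemma power_ideal_add:
  assumes "f \<in> power_ideal" and "g \<in> power_ideal"
  shows "f + g \<in> power_ideal"
proof (cases "CHAR('b) = 0")
  case False
  with assms obtain u v where
    "f = (\<Sum>i\<in>UNIV. u i * pvar i ^ CHAR('b))" "g = (\<Sum>i\<in>UNIV. v i * pvar i ^ CHAR('b))"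
    unfolding power_ideal_def by auto
  then have "f + g = (\<Sum>i\<in>UNIV. (u i + v i) * pvar i ^ CHAR('b))"
    by (simp add: distrib_right sum.distrib)
  with False show ?thesis
    unfolding power_ideal_def by (auto intro!: rangeI)
qed (use assms in \<open>simp add: power_ideal_def\<close>)

lemma power_ideal_mult:
  assumes "f \<in> power_ideal"
  shows "h * f \<in> power_ideal"
proof (cases "CHAR('b) = 0")
  case False
  with assms obtain u where "f = (\<Sum>i\<in>UNIV. u i * pvar i ^ CHAR('b))"
    unfolding power_ideal_def by auto
  then have "h * f = (\<Sum>i\<in>UNIV. (h * u i) * pvar i ^ CHAR('b))"
    by (simp add: sum_distrib_left mult.assoc)
  with False show ?thesis
    unfolding power_ideal_def by (auto intro!: rangeI)
qed (use assms in \<open>simp add: power_ideal_def\<close>)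

lemma power_ideal_zero: "0 \<in> power_ideal"
  unfolding power_ideal_def by (auto intro!: image_eqI[where x = "\<lambda>_. 0"])

lemma power_ideal_uminus: "f \<in> power_ideal \<Longrightarrow> - f \<in> power_ideal"
  using power_ideal_mult[of f "-1"] by simp

lemma pm_sum_single: "f = (\<Sum>a\<in>Poly_Mapping.keys f. Poly_Mapping.single a (Poly_Mapping.lookup f a))"
  by (rule poly_mapping_eqI)
    (auto simp: lookup_sum lookup_single when_def in_keys_iff)

lemma lookup_ppderiv:
  "Poly_Mapping.lookup (ppderiv i f) a
     = of_nat (Poly_Mapping.lookup a i + 1) * Poly_Mapping.lookup f (a + Poly_Mapping.single i 1)"
  by transfer simp

lemma ppderiv_add: "ppderiv i (f + g) = ppderiv i f + ppderiv i g"
  by (rule poly_mapping_eqI) (simp add: lookup_ppderiv lookup_add algebra_simps)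

lemma ppderiv_zero: "ppderiv i 0 = 0"
  by (rule poly_mapping_eqI) (simp add: lookup_ppderiv)

lemma ppderiv_sum: "ppderiv i (sum f A) = (\<Sum>a\<in>A. ppderiv i (f a))"
  by (induction A rule: infinite_finite_induct) (simp_all add: ppderiv_zero ppderiv_add)

lemma ppderiv_single:
  "ppderiv i (Poly_Mapping.single a c)
     = Poly_Mapping.single (a - Poly_Mapping.single i 1) (of_nat (Poly_Mapping.lookup a i) * c)"
proof (rule poly_mapping_eqI)
  fix b
  let ?e = "Poly_Mapping.single i (1::nat)"
  show "Poly_Mapping.lookup (ppderiv i (Poly_Mapping.single a c)) b = Poly_Mapping.lookup
      (Poly_Mapping.single (a - ?e) (of_nat (Poly_Mapping.lookup a i) * c)) b"
  proof (cases "a = b + ?e")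
    case True
    then have "a - ?e = b" "Poly_Mapping.lookup a i = Poly_Mapping.lookup b i + 1"
      by (simp_all add: lookup_add)
    with True show ?thesis
      by (simp add: lookup_ppderiv)
  next
    case False
    have "Poly_Mapping.lookup a i = 0 \<or> a - ?e \<noteq> b"
    proof (rule ccontr)
      assume "\<not> ?thesis"
      then have "Poly_Mapping.lookup a i \<noteq> 0" "b = a - ?e" by auto
      then have "Poly_Mapping.lookup a j = Poly_Mapping.lookup (b + ?e) j" for j
        by (cases "i = j") (simp_all add: lookup_add lookup_minus lookup_single_not_eq)
      with False show False
        using poly_mapping_eqI by blast
    qed
    with False show ?thesis
      by (auto simp: lookup_ppderiv lookup_single_not_eq)
  qed
qed

lemma ppderiv_mult_single:
  "ppderiv i (Poly_Mapping.single a c * Poly_Mapping.single b d)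
     = ppderiv i (Poly_Mapping.single a c) * Poly_Mapping.single b d
       + Poly_Mapping.single a c * ppderiv i (Poly_Mapping.single b d)"
proof -
  let ?e = "Poly_Mapping.single i (1::nat)"
  have shift: "Poly_Mapping.single (a - ?e + b) (of_nat (Poly_Mapping.lookup a i) * r)
      = Poly_Mapping.single (a + b - ?e) (of_nat (Poly_Mapping.lookup a i) * r)" for a b and r :: 'b
  proof (cases "Poly_Mapping.lookup a i = 0")
    case False
    then have "Poly_Mapping.lookup (a - ?e + b) j = Poly_Mapping.lookup (a + b - ?e) j" for j
      by (cases "i = j") (simp_all add: lookup_add lookup_minus lookup_single_not_eq)
    then have "a - ?e + b = a + b - ?e"
      by (rule poly_mapping_eqI)
    then show ?thesis by simp
  qed simp
  have 1: "ppderiv i (Poly_Mapping.single a c) * Poly_Mapping.single b d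
      = Poly_Mapping.single (a + b - ?e) (of_nat (Poly_Mapping.lookup a i) * (c * d))"
    by (simp only: ppderiv_single mult_single mult.assoc shift)
  have "Poly_Mapping.single a c * ppderiv i (Poly_Mapping.single b d)
      = Poly_Mapping.single (b - ?e + a) (of_nat (Poly_Mapping.lookup b i) * (c * d))"
    by (simp only: ppderiv_single mult_single add.commute mult.left_commute)
  also have "\<dots> = Poly_Mapping.single (a + b - ?e) (of_nat (Poly_Mapping.lookup b i) * (c * d))"
    unfolding shift by (simp only: add.commute)
  finally have 2: "Poly_Mapping.single a c * ppderiv i (Poly_Mapping.single b d)
      = Poly_Mapping.single (a + b - ?e) (of_nat (Poly_Mapping.lookup b i) * (c * d))" .
  show ?thesis
    unfolding 1 2
    by (simp only: mult_single ppderiv_single lookup_add of_nat_add distrib_right single_add)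
qed

lemma ppderiv_mult: "ppderiv i (f * g) = ppderiv i f * g + f * ppderiv i g"
proof -
  define S where "S = (\<lambda>(f :: ('a \<Rightarrow>\<^sub>0 nat) \<Rightarrow>\<^sub>0 'b) a. Poly_Mapping.single a (Poly_Mapping.lookup f a))"
  have S: "(\<Sum>a\<in>Poly_Mapping.keys f. S f a) = f" for f
    unfolding S_def by (rule pm_sum_single[symmetric])
  have "ppderiv i (S f a * S g b) = ppderiv i (S f a) * S g b + S f a * ppderiv i (S g b)" for a b
    unfolding S_def by (rule ppderiv_mult_single)
  then have "ppderiv i ((\<Sum>a\<in>A. S f a) * (\<Sum>b\<in>B. S g b))
      = ppderiv i (\<Sum>a\<in>A. S f a) * (\<Sum>b\<in>B. S g b) + (\<Sum>a\<in>A. S f a) * ppderiv i (\<Sum>b\<in>B. S g b)"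
    for A B
    by (simp only: sum_product ppderiv_sum sum.distrib)
  from this[of "Poly_Mapping.keys f" "Poly_Mapping.keys g"] show ?thesis
    unfolding S .
qed

lemma pvar_power:
  "pvar j ^ r = (Poly_Mapping.single (Poly_Mapping.single j r) 1 :: _ \<Rightarrow>\<^sub>0 'k::field)"
proof (induction r)
  case (Suc r)
  have "Poly_Mapping.single j 1 + Poly_Mapping.single j r = Poly_Mapping.single j (Suc r)"
    by (simp flip: single_add)
  with Suc show ?case
    by (simp add: pvar_def mult_single)
qed simp

lemma ppderiv_pvar_power: "ppderiv i (pvar j ^ CHAR('k) :: _ \<Rightarrow>\<^sub>0 'k::field) = 0"
  by (cases "i = j") (simp_all add: pvar_power ppderiv_single lookup_single_not_eq)

lemma power_ideal_ppderiv:
  assumes "f \<in> power_ideal"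
  shows "ppderiv i f \<in> power_ideal"
proof (cases "CHAR('b) = 0")
  case True
  with assms show ?thesis by (simp add: power_ideal_def ppderiv_zero)
next
  case False
  with assms obtain u where "f = (\<Sum>j\<in>UNIV. u j * pvar j ^ CHAR('b))"
    unfolding power_ideal_def by auto
  then have "ppderiv i f = (\<Sum>j\<in>UNIV. ppderiv i (u j) * pvar j ^ CHAR('b))"
    by (simp add: ppderiv_sum ppderiv_mult ppderiv_pvar_power)
  with False show ?thesis
    unfolding power_ideal_def by (auto intro!: rangeI)
qed

lemma lookup_mult_single_zero:
  assumes "b \<noteq> (0 :: 'n \<Rightarrow>\<^sub>0 nat)"
  shows "Poly_Mapping.lookup (g * Poly_Mapping.single b c) 0 = 0"
proof -
  have "Poly_Mapping.lookup (Poly_Mapping.single a d * Poly_Mapping.single b c) 0 = 0" for a d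
  proof -
    obtain j where "Poly_Mapping.lookup b j \<noteq> 0"
      using assms poly_mapping_eqI[of b 0] by auto
    then have "Poly_Mapping.lookup (a + b) j \<noteq> Poly_Mapping.lookup 0 j"
      by (simp add: lookup_add)
    then have "a + b \<noteq> 0"
      by metis
    then show ?thesis
      by (simp only: mult_single lookup_single_not_eq not_False_eq_True)
  qed
  then have "Poly_Mapping.lookup ((\<Sum>a\<in>Poly_Mapping.keys g.
      Poly_Mapping.single a (Poly_Mapping.lookup g a)) * Poly_Mapping.single b c) 0 = 0"
    by (simp only: sum_distrib_right lookup_sum sum.neutral_const)
  then show ?thesis
    by (subst pm_sum_single[of g])
qed

lemma power_ideal_lookup_zero:
  fixes f :: "('n::finite \<Rightarrow>\<^sub>0 nat) \<Rightarrow>\<^sub>0 'k::field"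
  assumes "f \<in> power_ideal"
  shows "Poly_Mapping.lookup f 0 = 0"
proof (cases "CHAR('k) = 0")
  case True
  with assms show ?thesis by (simp add: power_ideal_def)
next
  case False
  with assms obtain u where f: "f = (\<Sum>j\<in>UNIV. u j * pvar j ^ CHAR('k))"
    unfolding power_ideal_def by auto
  have "Poly_Mapping.lookup (Poly_Mapping.single j CHAR('k)) j \<noteq> Poly_Mapping.lookup 0 j" for j :: 'n
    using False by simp
  then have "Poly_Mapping.single j CHAR('k) \<noteq> 0" for j :: 'n
    by metis
  then show ?thesis
    unfolding f pvar_power lookup_sum by (simp add: lookup_mult_single_zero)
qed

definition tp_rel :: "(('n::finite \<Rightarrow>\<^sub>0 nat) \<Rightarrow>\<^sub>0 'k::field) \<Rightarrow> (('n \<Rightarrow>\<^sub>0 nat) \<Rightarrow>\<^sub>0 'k) \<Rightarrow> bool" where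
  "tp_rel f g \<longleftrightarrow> f - g \<in> power_ideal"

quotient_type (overloaded) ('n, 'k) trunc_poly = "('n::finite \<Rightarrow>\<^sub>0 nat) \<Rightarrow>\<^sub>0 'k::field" / tp_rel
proof (rule equivpI)
  show "reflp tp_rel"
    by (simp add: reflp_def tp_rel_def power_ideal_zero)
  show "symp tp_rel"
  proof (rule sympI)
    fix f g
    assume "tp_rel f g"
    then have "- (f - g) \<in> power_ideal"
      unfolding tp_rel_def by (rule power_ideal_uminus)
    then show "tp_rel g f"
      by (simp only: tp_rel_def minus_diff_eq)
  qed
  show "transp tp_rel"
  proof (rule transpI)
    fix f g h
    assume "tp_rel f g" "tp_rel g h"
    then have "(f - g) + (g - h) \<in> power_ideal"
      unfolding tp_rel_def by (rule power_ideal_add)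
    then show "tp_rel f h"
      by (simp add: tp_rel_def)
  qed
qed

instantiation trunc_poly :: (finite, field) comm_ring_1
begin

lift_definition zero_trunc_poly :: "('a, 'b) trunc_poly" is 0 .

lift_definition one_trunc_poly :: "('a, 'b) trunc_poly" is 1 .

lift_definition plus_trunc_poly :: "('a, 'b) trunc_poly \<Rightarrow> ('a, 'b) trunc_poly \<Rightarrow> ('a, 'b) trunc_poly"
  is "(+)"
  unfolding tp_rel_def add_diff_add by (rule power_ideal_add)

lift_definition uminus_trunc_poly :: "('a, 'b) trunc_poly \<Rightarrow> ('a, 'b) trunc_poly" is uminus
  unfolding tp_rel_def minus_diff_minus by (rule power_ideal_uminus)

lift_definition minus_trunc_poly :: "('a, 'b) trunc_poly \<Rightarrow> ('a, 'b) trunc_poly \<Rightarrow> ('a, 'b) trunc_poly"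
  is "(-)"
proof -
  fix f f' g g' :: "('a \<Rightarrow>\<^sub>0 nat) \<Rightarrow>\<^sub>0 'b"
  assume "tp_rel f f'" "tp_rel g g'"
  then have "(f - f') + - (g - g') \<in> power_ideal"
    unfolding tp_rel_def by (intro power_ideal_add power_ideal_uminus)
  then show "tp_rel (f - g) (f' - g')"
    by (simp add: tp_rel_def algebra_simps)
qed

lift_definition times_trunc_poly :: "('a, 'b) trunc_poly \<Rightarrow> ('a, 'b) trunc_poly \<Rightarrow> ('a, 'b) trunc_poly"
  is "(*)"
proof -
  fix f f' g g' :: "('a \<Rightarrow>\<^sub>0 nat) \<Rightarrow>\<^sub>0 'b"
  assume "tp_rel f f'" "tp_rel g g'"
  then have "g * (f - f') + f' * (g - g') \<in> power_ideal"
    unfolding tp_rel_def by (intro power_ideal_add power_ideal_mult)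
  then show "tp_rel (f * g) (f' * g')"
    by (simp add: tp_rel_def algebra_simps)
qed

instance
proof
  show "(0 :: ('a, 'b) trunc_poly) \<noteq> 1"
    by transfer (auto simp: tp_rel_def lookup_one dest: power_ideal_lookup_zero)
qed (transfer, simp add: tp_rel_def algebra_simps power_ideal_zero)+

end

lift_definition tp_scale :: "'k::field \<Rightarrow> ('n::finite, 'k) trunc_poly \<Rightarrow> ('n, 'k) trunc_poly"
  is "\<lambda>c f. Poly_Mapping.single 0 c * f"
  unfolding tp_rel_def right_diff_distrib[symmetric] by (rule power_ideal_mult)

lift_definition tp_var :: "'n::finite \<Rightarrow> ('n, 'k::field) trunc_poly" is pvar .

lift_definition tp_pderiv :: "'n::finite \<Rightarrow> ('n, 'k::field) trunc_poly \<Rightarrow> ('n, 'k) trunc_poly"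
  is ppderiv
proof -
  fix i :: 'n and f g :: "('n \<Rightarrow>\<^sub>0 nat) \<Rightarrow>\<^sub>0 'k"
  assume "tp_rel f g"
  then have "ppderiv i (f - g) \<in> power_ideal"
    unfolding tp_rel_def by (rule power_ideal_ppderiv)
  moreover have "ppderiv i f = ppderiv i (f - g) + ppderiv i g"
    by (simp flip: ppderiv_add)
  ultimately show "tp_rel (ppderiv i f) (ppderiv i g)"
    by (simp add: tp_rel_def)
qed

text \<open>The augmentation \<open>\<epsilon>\<close>: it sends a polynomial to its constant coefficient.\<close>

lift_definition tp_eps :: "('n::finite, 'k::field) trunc_poly \<Rightarrow> 'k"
  is "\<lambda>f. Poly_Mapping.lookup f 0"
  using power_ideal_lookup_zero by (fastforce simp: tp_rel_def lookup_minus)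

definition derivations :: "(('n::finite, 'k::field) trunc_poly \<Rightarrow> ('n, 'k) trunc_poly) set" where
  "derivations = {\<delta>. Vector_Spaces.linear tp_scale tp_scale \<delta> \<and> (\<forall>f g. \<delta> (f * g) = \<delta> f * g + f * \<delta> g)}"

section \<open>Lie algebras\<close>

locale lie_algebra = vector_space scale
  for scale :: "'k::field \<Rightarrow> 'l::ab_group_add \<Rightarrow> 'l" +
  fixes br :: "'l \<Rightarrow> 'l \<Rightarrow> 'l"
  assumes br_add_left: "br (a + b) c = br a c + br b c"
    and br_add_right: "br a (b + c) = br a b + br a c"
    and br_scale_left: "br (scale r a) b = scale r (br a b)"
    and br_scale_right: "br a (scale r b) = scale r (br a b)"
    and br_self: "br a a = 0"
    and jacobi: "br a (br b c) + br b (br c a) + br c (br a b) = 0"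

definition lie_subalgebra ::
  "('k::field \<Rightarrow> 'l::ab_group_add \<Rightarrow> 'l) \<Rightarrow> ('l \<Rightarrow> 'l \<Rightarrow> 'l) \<Rightarrow> 'l set \<Rightarrow> bool" where
  "lie_subalgebra scale br S \<longleftrightarrow> module.subspace scale S \<and> (\<forall>a\<in>S. \<forall>b\<in>S. br a b \<in> S)"

definition lie_ideal ::
  "('k::field \<Rightarrow> 'l::ab_group_add \<Rightarrow> 'l) \<Rightarrow> ('l \<Rightarrow> 'l \<Rightarrow> 'l) \<Rightarrow> 'l set \<Rightarrow> bool" where
  "lie_ideal scale br J \<longleftrightarrow> module.subspace scale J \<and> (\<forall>a. \<forall>b\<in>J. br a b \<in> J)"

definition lie_semidirect ::
  "('k::field \<Rightarrow> 'l::ab_group_add \<Rightarrow> 'l) \<Rightarrow> ('l \<Rightarrow> 'l \<Rightarrow> 'l) \<Rightarrow> 'l set \<Rightarrow> 'l set \<Rightarrow> bool" where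
  "lie_semidirect scale br H L0 \<longleftrightarrow> lie_ideal scale br H \<and> lie_subalgebra scale br L0
     \<and> H \<inter> L0 = {0} \<and> (\<forall>a. \<exists>h\<in>H. \<exists>b\<in>L0. a = h + b)"

definition fin_dim_subspace :: "('k::field \<Rightarrow> 'l::ab_group_add \<Rightarrow> 'l) \<Rightarrow> 'l set \<Rightarrow> bool" where
  "fin_dim_subspace scale S \<longleftrightarrow> (\<exists>B. finite B \<and> S = module.span scale B)"

section \<open>The tensor product \<open>X \<otimes> L\<close> and the wreath product \<open>L \<wr> Der X\<close>\<close>

definition tensor_rels ::
  "('k::field \<Rightarrow> 'x::ab_group_add \<Rightarrow> 'x) \<Rightarrow> ('k \<Rightarrow> 'l::ab_group_add \<Rightarrow> 'l) \<Rightarrow> ('x \<times> 'l \<Rightarrow>\<^sub>0 'k) set" where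
  "tensor_rels sX sL =
     {Poly_Mapping.single (x + x', a) 1 - Poly_Mapping.single (x, a) 1 - Poly_Mapping.single (x', a) 1 | x x' a. True}
   \<union> {Poly_Mapping.single (x, a + a') 1 - Poly_Mapping.single (x, a) 1 - Poly_Mapping.single (x, a') 1 | x a a'. True}
   \<union> {Poly_Mapping.single (sX c x, a) 1 - Poly_Mapping.single (x, a) c | c x a. True}
   \<union> {Poly_Mapping.single (x, sL c a) 1 - Poly_Mapping.single (x, a) c | c x a. True}"

type_synonym ('n, 'k, 'l) XL_formal = "('n, 'k) trunc_poly \<times> 'l \<Rightarrow>\<^sub>0 'k"

definition XL_class ::
  "('k::field \<Rightarrow> 'l::ab_group_add \<Rightarrow> 'l) \<Rightarrow> ('n::finite, 'k, 'l) XL_formal \<Rightarrow> ('n, 'k, 'l) XL_formal set" where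
  "XL_class sL f = coset_of (module.span pm_scale (tensor_rels tp_scale sL)) f"

text \<open>The element \<open>\<Sum>i\<in>I. x i \<otimes> a i\<close> of \<open>X \<otimes> L\<close>.\<close>

definition XL_sum ::
  "('k::field \<Rightarrow> 'l::ab_group_add \<Rightarrow> 'l) \<Rightarrow> 'i set \<Rightarrow> ('i \<Rightarrow> ('n::finite, 'k) trunc_poly) \<Rightarrow> ('i \<Rightarrow> 'l)
    \<Rightarrow> ('n, 'k, 'l) XL_formal set" where
  "XL_sum sL I x a = XL_class sL (\<Sum>i\<in>I. Poly_Mapping.single (x i, a i) 1)"

text \<open>The image of \<open>X \<otimes> S\<close> in \<open>X \<otimes> L\<close>, for a subspace \<open>S\<close> of \<open>L\<close>.\<close>

definition XL_sub ::
  "('k::field \<Rightarrow> 'l::ab_group_add \<Rightarrow> 'l) \<Rightarrow> 'l set \<Rightarrow> ('n::finite, 'k, 'l) XL_formal set set" where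
  "XL_sub sL S = XL_class sL ` {f. Poly_Mapping.keys f \<subseteq> UNIV \<times> S}"

definition XL_zero :: "('k::field \<Rightarrow> 'l::ab_group_add \<Rightarrow> 'l) \<Rightarrow> ('n::finite, 'k, 'l) XL_formal set" where
  "XL_zero sL = XL_class sL 0"

definition XL_add ::
  "('k::field \<Rightarrow> 'l::ab_group_add \<Rightarrow> 'l) \<Rightarrow> ('n::finite, 'k, 'l) XL_formal set \<Rightarrow> ('n, 'k, 'l) XL_formal set
    \<Rightarrow> ('n, 'k, 'l) XL_formal set" where
  "XL_add sL t u = XL_class sL (coset_rep t + coset_rep u)"

definition XL_scale ::
  "('k::field \<Rightarrow> 'l::ab_group_add \<Rightarrow> 'l) \<Rightarrow> 'k \<Rightarrow> ('n::finite, 'k, 'l) XL_formal set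
    \<Rightarrow> ('n, 'k, 'l) XL_formal set" where
  "XL_scale sL c t = XL_class sL (pm_scale c (coset_rep t))"

definition XL_bracket ::
  "('k::field \<Rightarrow> 'l::ab_group_add \<Rightarrow> 'l) \<Rightarrow> ('l \<Rightarrow> 'l \<Rightarrow> 'l)
    \<Rightarrow> ('n::finite, 'k, 'l) XL_formal set \<Rightarrow> ('n, 'k, 'l) XL_formal set \<Rightarrow> ('n, 'k, 'l) XL_formal set" where
  "XL_bracket sL br t u = XL_class sL
     (pm_ext pm_scale (\<lambda>(x, a). pm_ext pm_scale (\<lambda>(z, b). Poly_Mapping.single (x * z, br a b) 1)
        (coset_rep u)) (coset_rep t))"

text \<open>The map \<open>\<delta> \<otimes> id\<close> on \<open>X \<otimes> L\<close>.\<close>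

definition XL_der ::
  "('k::field \<Rightarrow> 'l::ab_group_add \<Rightarrow> 'l) \<Rightarrow> (('n::finite, 'k) trunc_poly \<Rightarrow> ('n, 'k) trunc_poly)
    \<Rightarrow> ('n, 'k, 'l) XL_formal set \<Rightarrow> ('n, 'k, 'l) XL_formal set" where
  "XL_der sL \<delta> t = XL_class sL
     (pm_ext pm_scale (\<lambda>(x, a). Poly_Mapping.single (\<delta> x, a) 1) (coset_rep t))"

text \<open>
  The value at \<open>t\<close> of the linear map on \<open>X \<otimes> L\<close> induced by a bilinear map \<open>B\<close>; it does not depend
  on the representative of \<open>t\<close> that is used.
\<close>

definition XL_lift ::
  "('k::field \<Rightarrow> 'v::ab_group_add \<Rightarrow> 'v) \<Rightarrow> (('n::finite, 'k) trunc_poly \<Rightarrow> 'l \<Rightarrow> 'v)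
    \<Rightarrow> ('n, 'k, 'l) XL_formal set \<Rightarrow> 'v" where
  "XL_lift s B t = pm_ext s (\<lambda>(x, a). B x a) (coset_rep t)"

type_synonym ('n, 'k, 'l) wreath =
  "('n, 'k, 'l) XL_formal set \<times> (('n, 'k) trunc_poly \<Rightarrow> ('n, 'k) trunc_poly)"

definition wreath_carrier :: "('k::field \<Rightarrow> 'l::ab_group_add \<Rightarrow> 'l) \<Rightarrow> ('n::finite, 'k, 'l) wreath set" where
  "wreath_carrier sL = range (XL_class sL) \<times> derivations"

definition wreath_add ::
  "('k::field \<Rightarrow> 'l::ab_group_add \<Rightarrow> 'l) \<Rightarrow> ('n::finite, 'k, 'l) wreath \<Rightarrow> ('n, 'k, 'l) wreath
    \<Rightarrow> ('n, 'k, 'l) wreath" where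
  "wreath_add sL v w = (XL_add sL (fst v) (fst w), \<lambda>x. snd v x + snd w x)"

definition wreath_scale ::
  "('k::field \<Rightarrow> 'l::ab_group_add \<Rightarrow> 'l) \<Rightarrow> 'k \<Rightarrow> ('n::finite, 'k, 'l) wreath \<Rightarrow> ('n, 'k, 'l) wreath" where
  "wreath_scale sL c v = (XL_scale sL c (fst v), \<lambda>x. tp_scale c (snd v x))"

text \<open>\<open>[t + \<delta>, u + \<eta>] = [t, u] + \<delta>(u) - \<eta>(t) + [\<delta>, \<eta>]\<close>\<close>

definition wreath_bracket ::
  "('k::field \<Rightarrow> 'l::ab_group_add \<Rightarrow> 'l) \<Rightarrow> ('l \<Rightarrow> 'l \<Rightarrow> 'l)
    \<Rightarrow> ('n::finite, 'k, 'l) wreath \<Rightarrow> ('n, 'k, 'l) wreath \<Rightarrow> ('n, 'k, 'l) wreath" where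
  "wreath_bracket sL br v w =
     (XL_add sL (XL_add sL (XL_bracket sL br (fst v) (fst w)) (XL_der sL (snd v) (fst w)))
        (XL_scale sL (- 1) (XL_der sL (snd w) (fst v))),
      \<lambda>x. snd v (snd w x) - snd w (snd v x))"

definition wreath_hom ::
  "('k::field \<Rightarrow> 'l::ab_group_add \<Rightarrow> 'l) \<Rightarrow> ('l \<Rightarrow> 'l \<Rightarrow> 'l) \<Rightarrow> ('l \<Rightarrow> ('n::finite, 'k, 'l) wreath) \<Rightarrow> bool" where
  "wreath_hom sL br \<psi> \<longleftrightarrow>
     (\<forall>a. \<psi> a \<in> wreath_carrier sL)
   \<and> (\<forall>a b. \<psi> (a + b) = wreath_add sL (\<psi> a) (\<psi> b))
   \<and> (\<forall>c a. \<psi> (sL c a) = wreath_scale sL c (\<psi> a))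
   \<and> (\<forall>a b. \<psi> (br a b) = wreath_bracket sL br (\<psi> a) (\<psi> b))"

definition wreath_mono ::
  "('k::field \<Rightarrow> 'l::ab_group_add \<Rightarrow> 'l) \<Rightarrow> ('l \<Rightarrow> 'l \<Rightarrow> 'l) \<Rightarrow> ('l \<Rightarrow> ('n::finite, 'k, 'l) wreath) \<Rightarrow> bool" where
  "wreath_mono sL br \<psi> \<longleftrightarrow> wreath_hom sL br \<psi> \<and> inj \<psi>"

text \<open>\<open>Ker (\<pi>\<psi>)\<close>, and the virtual endomorphism \<open>\<theta> = (\<epsilon> \<otimes> id)\<psi>\<close> (only used on \<open>Ker (\<pi>\<psi>)\<close>).\<close>

definition ker_pi :: "('l \<Rightarrow> ('n::finite, 'k::field, 'l) wreath) \<Rightarrow> 'l set" where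
  "ker_pi \<psi> = {a. snd (\<psi> a) = (\<lambda>x. 0)}"

definition virt_endo ::
  "('k::field \<Rightarrow> 'l::ab_group_add \<Rightarrow> 'l) \<Rightarrow> ('l \<Rightarrow> ('n::finite, 'k, 'l) wreath) \<Rightarrow> 'l \<Rightarrow> 'l" where
  "virt_endo sL \<psi> h = XL_lift sL (\<lambda>x a. sL (tp_eps x) a) (fst (\<psi> h))"

text \<open>
  \<open>y\<^sub>1\<^bsup>i1\<^esup> \<dots> y\<^sub>n\<^bsup>in\<^esup> \<circ> h\<close>, where the order of the factors is the linear order of the index type.
\<close>

definition ad_monomial ::
  "('l \<Rightarrow> 'l \<Rightarrow> 'l) \<Rightarrow> ('n::{finite, linorder} \<Rightarrow> 'l) \<Rightarrow> ('n \<Rightarrow> nat) \<Rightarrow> 'l \<Rightarrow> 'l" where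
  "ad_monomial br y \<alpha> h = foldr (\<lambda>i. br (y i) ^^ \<alpha> i) (sorted_list_of_set UNIV) h"

definition finite_state ::
  "('k::field \<Rightarrow> 'l::ab_group_add \<Rightarrow> 'l) \<Rightarrow> ('l \<Rightarrow> ('n::finite, 'k, 'l) wreath) \<Rightarrow> 'l \<Rightarrow> bool" where
  "finite_state sL \<psi> a \<longleftrightarrow>
     (\<exists>S. fin_dim_subspace sL S \<and> a \<in> S \<and> \<psi> ` S \<subseteq> XL_sub sL S \<times> derivations)"

section \<open>The tensor algebra of \<open>X\<close>\<close>

text \<open>
  The direct sum of all tensor powers of \<open>X\<close> is the free vector space on the words \<open>[v\<^sub>1, \<dots>, v\<^sub>r]\<close>
  in \<open>X\<close> modulo multilinearity in each letter.
\<close>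

definition tens_rels :: "(('n::finite, 'k::field) trunc_poly list \<Rightarrow>\<^sub>0 'k) set" where
  "tens_rels =
     {Poly_Mapping.single (u @ [x + x'] @ v) 1 - Poly_Mapping.single (u @ [x] @ v) 1
        - Poly_Mapping.single (u @ [x'] @ v) 1 | u v x x'. True}
   \<union> {Poly_Mapping.single (u @ [tp_scale c x] @ v) 1 - Poly_Mapping.single (u @ [x] @ v) c | u v c x. True}"

definition tens_rel ::
  "(('n::finite, 'k::field) trunc_poly list \<Rightarrow>\<^sub>0 'k) \<Rightarrow> (('n, 'k) trunc_poly list \<Rightarrow>\<^sub>0 'k) \<Rightarrow> bool" where
  "tens_rel f g \<longleftrightarrow> f - g \<in> module.span pm_scale tens_rels"

quotient_type (overloaded) ('n, 'k) tens_alg = "('n::finite, 'k::field) trunc_poly list \<Rightarrow>\<^sub>0 'k" / tens_rel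
proof (rule equivpI)
  show "reflp tens_rel"
    by (simp add: reflp_def tens_rel_def pm.span_zero)
  show "symp tens_rel"
  proof (rule sympI)
    fix f g
    assume "tens_rel f g"
    then have "- (f - g) \<in> module.span pm_scale tens_rels"
      unfolding tens_rel_def by (rule pm.span_neg)
    then show "tens_rel g f"
      by (simp only: tens_rel_def minus_diff_eq)
  qed
  show "transp tens_rel"
  proof (rule transpI)
    fix f g h
    assume "tens_rel f g" "tens_rel g h"
    then have "(f - g) + (g - h) \<in> module.span pm_scale tens_rels"
      unfolding tens_rel_def by (rule pm.span_add)
    then show "tens_rel f h"
      by (simp add: tens_rel_def)
  qed
qed

instantiation tens_alg :: (finite, field) ab_group_add
begin

lift_definition zero_tens_alg :: "('a, 'b) tens_alg" is 0 .

lift_definition plus_tens_alg :: "('a, 'b) tens_alg \<Rightarrow> ('a, 'b) tens_alg \<Rightarrow> ('a, 'b) tens_alg"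
  is "(+)"
  unfolding tens_rel_def add_diff_add by (rule pm.span_add)

lift_definition uminus_tens_alg :: "('a, 'b) tens_alg \<Rightarrow> ('a, 'b) tens_alg" is uminus
  unfolding tens_rel_def minus_diff_minus by (rule pm.span_neg)

lift_definition minus_tens_alg :: "('a, 'b) tens_alg \<Rightarrow> ('a, 'b) tens_alg \<Rightarrow> ('a, 'b) tens_alg"
  is "(-)"
proof -
  fix f f' g g' :: "('a, 'b) trunc_poly list \<Rightarrow>\<^sub>0 'b"
  assume "tens_rel f f'" "tens_rel g g'"
  then have "(f - f') - (g - g') \<in> module.span pm_scale tens_rels"
    unfolding tens_rel_def by (rule pm.span_diff)
  then show "tens_rel (f - g) (f' - g')"
    by (simp add: tens_rel_def algebra_simps)
qed

instance
  by intro_classes (transfer, simp add: tens_rel_def algebra_simps pm.span_zero)+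

end

lift_definition tens_scale :: "'k::field \<Rightarrow> ('n::finite, 'k) tens_alg \<Rightarrow> ('n, 'k) tens_alg"
  is pm_scale
  unfolding tens_rel_def pm.scale_right_diff_distrib[symmetric] by (rule pm.span_scale)

definition tens :: "('n::finite, 'k::field) trunc_poly list \<Rightarrow> ('n, 'k) tens_alg" where
  "tens w = abs_tens_alg (Poly_Mapping.single w 1)"

definition tens_power :: "nat \<Rightarrow> ('n::finite, 'k::field) tens_alg set" where
  "tens_power r = module.span tens_scale (tens ` {w. length w = r})"

text \<open>The value at \<open>t\<close> of the linear map that is given on words by a multilinear map \<open>B\<close>.\<close>

definition tens_lift ::
  "('k::field \<Rightarrow> 'v::ab_group_add \<Rightarrow> 'v) \<Rightarrow> (('n::finite, 'k) trunc_poly list \<Rightarrow> 'v)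
    \<Rightarrow> ('n, 'k) tens_alg \<Rightarrow> 'v" where
  "tens_lift s B t = pm_ext s B (rep_tens_alg t)"

definition tens_cons ::
  "('n::finite, 'k::field) trunc_poly \<Rightarrow> ('n, 'k) tens_alg \<Rightarrow> ('n, 'k) tens_alg" where
  "tens_cons x t = tens_lift tens_scale (\<lambda>w. tens (x # w)) t"

section \<open>The induced action\<close>

text \<open>The empty word only concerns the tensor power \<open>k\<close> of exponent zero, on which \<open>L\<close> acts trivially.\<close>

fun act_word ::
  "('l \<Rightarrow> ('n::finite, 'k::field, 'l) wreath) \<Rightarrow> 'l \<Rightarrow> ('n, 'k) trunc_poly list \<Rightarrow> ('n, 'k) tens_alg" where
  "act_word \<psi> a [] = 0"
| "act_word \<psi> a [v] = tens [snd (\<psi> a) v]"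
| "act_word \<psi> a (v # v' # w) =
     XL_lift tens_scale (\<lambda>z b. tens_cons (z * v) (act_word \<psi> b (v' # w))) (fst (\<psi> a))
     + tens (snd (\<psi> a) v # v' # w)"

definition act ::
  "('l \<Rightarrow> ('n::finite, 'k::field, 'l) wreath) \<Rightarrow> 'l \<Rightarrow> ('n, 'k) tens_alg \<Rightarrow> ('n, 'k) tens_alg" where
  "act \<psi> a t = tens_lift tens_scale (act_word \<psi> a) t"

text \<open>
  Since \<open>X \<otimes> L\<close> is itself a Lie algebra, the first condition of properness says that the image of
  \<open>\<psi>\<close> is not contained in \<open>X \<otimes> L\<close>.
\<close>

definition wreath_proper ::
  "('k::field \<Rightarrow> 'l::ab_group_add \<Rightarrow> 'l) \<Rightarrow> ('l \<Rightarrow> ('n::finite, 'k, 'l) wreath) \<Rightarrow> bool" where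
  "wreath_proper sL \<psi> \<longleftrightarrow> \<not> (\<forall>a. snd (\<psi> a) = (\<lambda>x. 0)) \<and> \<not> (\<forall>a. fst (\<psi> a) = XL_zero sL)"

definition self_similar ::
  "('k::field \<Rightarrow> 'l::ab_group_add \<Rightarrow> 'l) \<Rightarrow> ('l \<Rightarrow> 'l \<Rightarrow> 'l) \<Rightarrow> ('l \<Rightarrow> ('n::finite, 'k, 'l) wreath) \<Rightarrow> bool" where
  "self_similar sL br \<psi> \<longleftrightarrow> wreath_mono sL br \<psi> \<and> wreath_proper sL \<psi>"

definition faithful_self_similar ::
  "('k::field \<Rightarrow> 'l::ab_group_add \<Rightarrow> 'l) \<Rightarrow> ('l \<Rightarrow> 'l \<Rightarrow> 'l) \<Rightarrow> ('l \<Rightarrow> ('n::finite, 'k, 'l) wreath) \<Rightarrow> bool" where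
  "faithful_self_similar sL br \<psi> \<longleftrightarrow> wreath_mono sL br \<psi>
     \<and> (\<Inter>r\<in>{1..}. {a. \<forall>t\<in>tens_power r. act \<psi> a t = 0}) = {0}"

section \<open>The universal enveloping algebra and transitivity\<close>

text \<open>
  \<open>U(L)\<close> is the free associative algebra on the set \<open>L\<close> (the free vector space on words in \<open>L\<close>)
  modulo the two-sided ideal expressing that \<open>L \<rightarrow> U(L)\<close> is linear and maps \<open>[a, b]\<close> to \<open>ab - ba\<close>.
\<close>

definition env_rels ::
  "('k::field \<Rightarrow> 'l::ab_group_add \<Rightarrow> 'l) \<Rightarrow> ('l \<Rightarrow> 'l \<Rightarrow> 'l) \<Rightarrow> ('l list \<Rightarrow>\<^sub>0 'k) set" where
  "env_rels sL br =
     {Poly_Mapping.single (u @ [a + b] @ v) 1 - Poly_Mapping.single (u @ [a] @ v) 1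
        - Poly_Mapping.single (u @ [b] @ v) 1 | u v a b. True}
   \<union> {Poly_Mapping.single (u @ [sL c a] @ v) 1 - Poly_Mapping.single (u @ [a] @ v) c | u v c a. True}
   \<union> {Poly_Mapping.single (u @ [a, b] @ v) 1 - Poly_Mapping.single (u @ [b, a] @ v) 1
        - Poly_Mapping.single (u @ [br a b] @ v) 1 | u v a b. True}"

definition env_alg ::
  "('k::field \<Rightarrow> 'l::ab_group_add \<Rightarrow> 'l) \<Rightarrow> ('l \<Rightarrow> 'l \<Rightarrow> 'l) \<Rightarrow> ('l list \<Rightarrow>\<^sub>0 'k) set set" where
  "env_alg sL br = range (coset_of (module.span pm_scale (env_rels sL br)))"

text \<open>The action of \<open>U(L)\<close> induced by a representation \<open>\<rho>\<close> of \<open>L\<close> on a space with scalars \<open>s\<close>.\<close>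

definition env_act ::
  "('k::field \<Rightarrow> 'v::ab_group_add \<Rightarrow> 'v) \<Rightarrow> ('l \<Rightarrow> 'v \<Rightarrow> 'v) \<Rightarrow> ('l list \<Rightarrow>\<^sub>0 'k) set \<Rightarrow> 'v \<Rightarrow> 'v" where
  "env_act s \<rho> q v = pm_ext s (\<lambda>w. foldr \<rho> w v) (coset_rep q)"

definition cyclic_module ::
  "('k::field \<Rightarrow> 'l::ab_group_add \<Rightarrow> 'l) \<Rightarrow> ('l \<Rightarrow> 'l \<Rightarrow> 'l) \<Rightarrow> ('k \<Rightarrow> 'v::ab_group_add \<Rightarrow> 'v)
    \<Rightarrow> ('l \<Rightarrow> 'v \<Rightarrow> 'v) \<Rightarrow> 'v set \<Rightarrow> 'v \<Rightarrow> bool" where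
  "cyclic_module sL br s \<rho> V g \<longleftrightarrow> g \<in> V \<and> (\<lambda>u. env_act s \<rho> u g) ` env_alg sL br = V"

text \<open>
  Transitivity is meant for \<open>CARD('n) = 1\<close> and positive characteristic; then \<open>tp_var i\<close> is the
  only variable of \<open>X\<close>.
\<close>

definition transitive_action ::
  "('k::field \<Rightarrow> 'l::ab_group_add \<Rightarrow> 'l) \<Rightarrow> ('l \<Rightarrow> 'l \<Rightarrow> 'l) \<Rightarrow> ('l \<Rightarrow> ('n::finite, 'k, 'l) wreath) \<Rightarrow> bool" where
  "transitive_action sL br \<psi> \<longleftrightarrow> (\<forall>r\<ge>1. \<forall>i::'n.
     cyclic_module sL br tens_scale (act \<psi>) (tens_power r)
       (tens (replicate r (tp_var i ^ (CHAR('k) - 1)))))"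

definition transitive_self_similar ::
  "('k::field \<Rightarrow> 'l::ab_group_add \<Rightarrow> 'l) \<Rightarrow> ('l \<Rightarrow> 'l \<Rightarrow> 'l) \<Rightarrow> ('l \<Rightarrow> ('n::finite, 'k, 'l) wreath) \<Rightarrow> bool" where
  "transitive_self_similar sL br \<psi> \<longleftrightarrow> self_similar sL br \<psi> \<and> transitive_action sL br \<psi>"

end

theory Submission
  imports Defs
begin

text \<open>
  The relation \<open>\<psi>([y\<^sub>i, h]) = (\<partial>/\<partial>x\<^sub>i \<otimes> id) \<psi>(h)\<close> turns \<open>\<theta>(y\<^sup>\<alpha> \<circ> h)\<close> into the value at the origin of the
  \<open>\<alpha>\<close>-th derivative of \<open>\<psi>(h) \<in> X \<otimes> L\<close>, so that the formula for \<open>\<psi>(h)\<close> is Taylor's formula. An ideal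
  in \<open>Ker \<theta>\<close> is therefore killed by \<open>\<psi>\<close>, and a \<open>\<theta>\<close>-invariant ideal in \<open>H\<close> acts by zero on all tensor
  powers; conversely \<open>Ker \<psi>\<close> and the kernel of the action are such ideals, the latter because
  \<open>(\<epsilon> \<otimes> id)(h \<cdot> (1 \<otimes> t)) = \<theta>(h) \<cdot> t\<close>. For one variable in characteristic \<open>p\<close>, an element \<open>h \<in> H\<close> acts on
  \<open>x\<^bsup>p-1\<^esup> \<otimes> t\<close> as \<open>\<theta>(h)\<close> does on \<open>t\<close>, and \<open>y\<close> differentiates the first factor; transitivity follows by
  induction on the tensor power.
\<close>

text \<open>In characteristic 0 the exponents occurring in X are unbounded, so the expansion of an
  element of X \<otimes> L is obtained on a box whose size M depends on that element; hypothesis 3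
  removes the exponents from m to M - 1. In characteristic p the choice m = p has two effects:
  exponents of p or more vanish in X, and for the remaining ones \<alpha>! is invertible. Elements
  of X \<otimes> L are cosets of formal sums, and the operations on them choose representatives.
  Linear maps out of X \<otimes> L are therefore handled through bilinear maps \<open>B\<close> into
  an arbitrary vector space, evaluated by \<open>XL_lift\<close>, without choosing a basis of L.
  Compatibility of the action with brackets has to be derived from its recursive definition: it
  makes the kernel of the action an ideal and lets U(L) act. In one variable p - 1 is the exponent
  at which multiplication by x gives 0 while repeated differentiation still reaches every lower
  power.\<close>

section \<open>Linear extensions\<close>

context vector_space
begin

text \<open>Supports change under addition and scaling; summing over a common finite superset turns
  such identities into termwise ones.\<close>

lemma pm_ext_superset:
  assumes "finite A" and "Poly_Mapping.keys f \<subseteq> A"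
  shows "pm_ext scale B f = (\<Sum>w\<in>A. scale (Poly_Mapping.lookup f w) (B w))"
  unfolding pm_ext_def using assms
  by (intro sum.mono_neutral_left) (auto simp: in_keys_iff)

lemma pm_ext_0 [simp]: "pm_ext scale B 0 = 0"
  by (simp add: pm_ext_def)

lemma pm_ext_single [simp]: "pm_ext scale B (Poly_Mapping.single w c) = scale c (B w)"
  by (subst pm_ext_superset[of "{w}"]) (auto simp: lookup_single)

lemma pm_ext_add: "pm_ext scale B (f + g) = pm_ext scale B f + pm_ext scale B g"
proof -
  let ?A = "Poly_Mapping.keys f \<union> Poly_Mapping.keys g"
  have "Poly_Mapping.keys (f + g) \<subseteq> ?A"
    by (rule Poly_Mapping.keys_add)
  then show ?thesis
    by (simp add: pm_ext_superset[of ?A] lookup_add scale_left_distrib sum.distrib)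
qed

lemma pm_ext_scale: "pm_ext scale B (pm_scale c f) = scale c (pm_ext scale B f)"
proof -
  have "Poly_Mapping.keys (pm_scale c f) \<subseteq> Poly_Mapping.keys f"
    by (auto simp: in_keys_iff)
  then show ?thesis
    by (simp add: pm_ext_superset[of "Poly_Mapping.keys f"] scale_sum_right)
qed

lemma pm_ext_minus: "pm_ext scale B (- f) = - pm_ext scale B f"
  using pm_ext_scale[of B "-1" f] pm.scale_minus_left[of 1 f] by simp

lemma pm_ext_diff: "pm_ext scale B (f - g) = pm_ext scale B f - pm_ext scale B g"
  using pm_ext_add[of B f "- g"] by (simp add: pm_ext_minus)

lemma pm_ext_sum: "pm_ext scale B (sum g A) = (\<Sum>a\<in>A. pm_ext scale B (g a))"
  by (induction A rule: infinite_finite_induct) (simp_all add: pm_ext_add)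

lemma pm_ext_fun_add: "pm_ext scale (\<lambda>w. B w + C w) f = pm_ext scale B f + pm_ext scale C f"
  by (simp add: pm_ext_def scale_right_distrib sum.distrib)

lemma pm_ext_fun_diff: "pm_ext scale (\<lambda>w. B w - C w) f = pm_ext scale B f - pm_ext scale C f"
  by (simp add: pm_ext_def scale_right_diff_distrib sum_subtractf)

lemma pm_ext_fun_scale: "pm_ext scale (\<lambda>w. scale c (B w)) f = scale c (pm_ext scale B f)"
  by (simp add: pm_ext_def scale_sum_right mult.commute)

lemma pm_ext_fun_0 [simp]: "pm_ext scale (\<lambda>w. 0) f = 0"
  by (simp add: pm_ext_def)

lemma pm_ext_swap:
  "pm_ext scale (\<lambda>w. pm_ext scale (\<lambda>v. B w v) g) f = pm_ext scale (\<lambda>v. pm_ext scale (\<lambda>w. B w v) f) g"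
  unfolding pm_ext_def scale_sum_right
  by (subst sum.swap) (simp add: mult.commute)

lemma pm_ext_linear:
  assumes "Vector_Spaces.linear scale s g"
  shows "g (pm_ext scale B f) = pm_ext s (\<lambda>w. g (B w)) f"
proof -
  interpret g: Vector_Spaces.linear scale s g
    by (rule assms)
  show ?thesis
    by (simp add: pm_ext_def g.sum g.scale)
qed

lemma pm_ext_pm_ext:
  "pm_ext scale B (pm_ext pm_scale G f) = pm_ext scale (\<lambda>w. pm_ext scale B (G w)) f"
proof -
  have "Vector_Spaces.linear pm_scale scale (pm_ext scale B)"
    by (simp add: Vector_Spaces.linear_iff vector_space_axioms vector_space_pm_scale
        pm_ext_add pm_ext_scale)
  then show ?thesis
    by (rule pm.pm_ext_linear)
qed

text \<open>A linear extension that kills the generators \<open>R\<close> factors through the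
  quotient by their span. This makes values computed from a chosen coset representative independent
  of the choice.\<close>

lemma pm_ext_vanishes_on_span:
  assumes "f \<in> module.span pm_scale R" and "\<And>r. r \<in> R \<Longrightarrow> pm_ext scale B r = 0"
  shows "pm_ext scale B f = 0"
  using assms(1)
proof (induction rule: pm.span_induct_alt)
  case base
  then show ?case by simp
next
  case (step c x z)
  then show ?case by (simp add: pm_ext_add pm_ext_scale assms(2))
qed

end

lemma pm_ext_single_self:
  fixes f :: "'a \<Rightarrow>\<^sub>0 'b::field"
  shows "pm_ext pm_scale (\<lambda>w. Poly_Mapping.single w 1) f = f"
proof -
  have *: "pm_scale c (Poly_Mapping.single w 1) = Poly_Mapping.single w c" for c :: 'b and w :: 'a
    by (rule poly_mapping_eqI) (simp add: lookup_single when_def)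
  show ?thesis
    unfolding pm_ext_def * by (rule pm_sum_single[symmetric])
qed

lemma coset_of_eq_iff:
  assumes "pm.subspace R"
  shows "coset_of R f = coset_of R g \<longleftrightarrow> f - g \<in> R"
proof
  assume "coset_of R f = coset_of R g"
  moreover have "f \<in> coset_of R f"
    by (simp add: coset_of_def pm.subspace_0[OF assms])
  ultimately show "f - g \<in> R"
    by (simp add: coset_of_def)
next
  assume *: "f - g \<in> R"
  show "coset_of R f = coset_of R g"
  proof (intro set_eqI)
    fix h
    have "h - g = (h - f) + (f - g)" "h - f = (h - g) - (f - g)" by simp_all
    then show "h \<in> coset_of R f \<longleftrightarrow> h \<in> coset_of R g"
      unfolding coset_of_def mem_Collect_eq
      using * pm.subspace_add[OF assms] pm.subspace_diff[OF assms] by metis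
  qed
qed

lemma coset_rep_coset_of:
  assumes "pm.subspace R"
  shows "coset_rep (coset_of R f) - f \<in> R"
proof -
  have "f \<in> coset_of R f"
    by (simp add: coset_of_def pm.subspace_0[OF assms])
  then have "coset_rep (coset_of R f) \<in> coset_of R f"
    unfolding coset_rep_def by (rule someI)
  then show ?thesis
    by (simp add: coset_of_def)
qed

section \<open>The vector spaces \<open>X\<close> and \<open>X\<^sup>\<otimes>\<^sup>r\<close>\<close>

lemma single_0_times: "Poly_Mapping.single 0 c * f = pm_scale c (f :: ('n::finite \<Rightarrow>\<^sub>0 nat) \<Rightarrow>\<^sub>0 'k::field)"
proof -
  have single: "pm_scale c (Poly_Mapping.single a d) = Poly_Mapping.single a (c * d)" for a :: "'n \<Rightarrow>\<^sub>0 nat" and d :: 'k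
    by (rule poly_mapping_eqI) (simp add: lookup_single when_def)
  have "Poly_Mapping.single 0 c * (\<Sum>a\<in>A. Poly_Mapping.single a (Poly_Mapping.lookup f a))
      = pm_scale c (\<Sum>a\<in>A. Poly_Mapping.single a (Poly_Mapping.lookup f a))" for A
    by (simp add: sum_distrib_left mult_single pm.scale_sum_right single)
  then show ?thesis
    by (metis pm_sum_single)
qed

lemma abs_trunc_poly_eq_iff: "abs_trunc_poly f = abs_trunc_poly g \<longleftrightarrow> f - g \<in> power_ideal"
  by (simp add: trunc_poly.abs_eq_iff tp_rel_def)

lemma tp_scale_mult_left: "tp_scale c x * y = tp_scale c (x * y)"
  by transfer (simp add: tp_rel_def power_ideal_zero mult.assoc)

lemma tp_scale_mult_right: "x * tp_scale c y = tp_scale c (x * y)"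
  using tp_scale_mult_left[of c y x] by (simp add: mult.commute)

lemma vector_space_tp_scale: "vector_space (tp_scale :: 'k::field \<Rightarrow> ('n::finite, 'k) trunc_poly \<Rightarrow> _)"
  by (unfold_locales; transfer)
    (simp_all add: tp_rel_def single_0_times power_ideal_zero pm.scale_left_distrib pm.scale_right_distrib)

interpretation tp: vector_space "tp_scale :: 'k::field \<Rightarrow> ('n::finite, 'k) trunc_poly \<Rightarrow> _"
  by (rule vector_space_tp_scale)

lemma tp_eps_add: "tp_eps (x + y) = tp_eps x + tp_eps y"
  by transfer (simp add: lookup_add)

lemma tp_eps_scale: "tp_eps (tp_scale c x) = c * tp_eps x"
  by transfer (simp add: single_0_times)

lemma derivationD:
  assumes "\<delta> \<in> derivations"
  shows "\<delta> (x + y) = \<delta> x + \<delta> y" "\<delta> (tp_scale c x) = tp_scale c (\<delta> x)" "\<delta> (x * y) = \<delta> x * y + x * \<delta> y"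
  using assms by (simp_all add: derivations_def Vector_Spaces.linear_iff)

lemma zero_derivation: "(\<lambda>x. 0) \<in> derivations"
  by (simp add: derivations_def Vector_Spaces.linear_iff vector_space_tp_scale)

lemma vector_space_tens_scale: "vector_space (tens_scale :: 'k::field \<Rightarrow> ('n::finite, 'k) tens_alg \<Rightarrow> _)"
  by unfold_locales
    (transfer, simp add: tens_rel_def pm.span_zero pm.scale_left_distrib pm.scale_right_distrib)+

interpretation tens: vector_space "tens_scale :: 'k::field \<Rightarrow> ('n::finite, 'k) tens_alg \<Rightarrow> _"
  by (rule vector_space_tens_scale)

section \<open>Multilinear maps on words and the tensor algebra\<close>

definition multilinear_on_words ::
  "('k::field \<Rightarrow> 'v::ab_group_add \<Rightarrow> 'v) \<Rightarrow> (('n::finite, 'k) trunc_poly list \<Rightarrow> 'v) \<Rightarrow> bool" where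
  "multilinear_on_words s B \<longleftrightarrow>
     (\<forall>u v x x'. B (u @ (x + x') # v) = B (u @ x # v) + B (u @ x' # v))
   \<and> (\<forall>u v c x. B (u @ tp_scale c x # v) = s c (B (u @ x # v)))"

lemma abs_tens_alg_eq_pm_ext: "abs_tens_alg f = pm_ext tens_scale tens f"
proof -
  have add: "abs_tens_alg (f + g) = abs_tens_alg f + abs_tens_alg g"
    for f g :: "('a, 'b) trunc_poly list \<Rightarrow>\<^sub>0 'b"
    by (simp add: plus_tens_alg.abs_eq)
  have "Vector_Spaces.linear pm_scale tens_scale (abs_tens_alg :: (('a, 'b) trunc_poly list \<Rightarrow>\<^sub>0 'b) \<Rightarrow> _)"
    by (simp add: Vector_Spaces.linear_iff vector_space_tens_scale vector_space_pm_scale add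
        tens_scale.abs_eq)
  from pm.pm_ext_linear[OF this, of "\<lambda>w. Poly_Mapping.single w 1" f] show ?thesis
    by (simp add: pm_ext_single_self tens_def[abs_def])
qed

text \<open>The two clauses of \<open>multilinear_on_words\<close> say that the extension of
  \<open>B\<close> kills \<open>tens_rels\<close>, so the representative picked by
  \<open>rep_tens_alg\<close> may be replaced by \<open>f\<close>.\<close>

lemma (in vector_space) tens_lift_abs:
  assumes "multilinear_on_words scale B"
  shows "tens_lift scale B (abs_tens_alg f) = pm_ext scale B f"
proof -
  have "tens_rel (rep_tens_alg (abs_tens_alg f)) f"
    by (metis Quotient3_abs_rep Quotient3_tens_alg tens_alg.abs_eq_iff)
  then have "pm_ext scale B (rep_tens_alg (abs_tens_alg f) - f) = 0"
    unfolding tens_rel_def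
    by (rule pm_ext_vanishes_on_span)
      (use assms in \<open>auto simp: tens_rels_def pm_ext_diff multilinear_on_words_def\<close>)
  then show ?thesis
    by (simp add: tens_lift_def pm_ext_diff)
qed

lemma tens_alg_exhaust: obtains f where "t = pm_ext tens_scale tens f" "t = abs_tens_alg f"
  using abs_tens_alg_eq_pm_ext by (metis Quotient3_abs_rep Quotient3_tens_alg)

text \<open>There is no separate case for 0, which is the zero multiple of any word.\<close>

lemma tens_alg_induct [case_names word add scale]:
  assumes "\<And>w. P (tens w)" and "\<And>t u. P t \<Longrightarrow> P u \<Longrightarrow> P (t + u)" and "\<And>c t. P t \<Longrightarrow> P (tens_scale c t)"
  shows "P t"
proof -
  have "P 0"
    using assms(1) assms(3)[of _ 0] by (metis tens.scale_zero_left)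
  then have *: "P (\<Sum>w\<in>A. tens_scale (c w) (tens w))" for A and c :: "_ \<Rightarrow> 'b"
    by (induction A rule: infinite_finite_induct) (simp_all add: assms)
  show ?thesis
    by (rule tens_alg_exhaust[of t]) (simp add: * pm_ext_def)
qed

context vector_space
begin

lemma tens_lift_tens [simp]: "multilinear_on_words scale B \<Longrightarrow> tens_lift scale B (tens w) = B w"
  unfolding tens_def by (simp add: tens_lift_abs)

lemma tens_lift_add:
  assumes "multilinear_on_words scale B"
  shows "tens_lift scale B (t + u) = tens_lift scale B t + tens_lift scale B u"
proof -
  obtain f g where t: "t = abs_tens_alg f" and u: "u = abs_tens_alg g"
    by (metis tens_alg_exhaust)
  have "t + u = abs_tens_alg (f + g)"
    by (simp add: t u plus_tens_alg.abs_eq)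
  then show ?thesis
    by (simp add: tens_lift_abs[OF assms] pm_ext_add t u)
qed

lemma tens_lift_scale:
  assumes "multilinear_on_words scale B"
  shows "tens_lift scale B (tens_scale c t) = scale c (tens_lift scale B t)"
proof -
  obtain f where t: "t = abs_tens_alg f"
    by (metis tens_alg_exhaust)
  have "tens_scale c t = abs_tens_alg (pm_scale c f)"
    by (simp add: t tens_scale.abs_eq)
  then show ?thesis
    by (simp add: tens_lift_abs[OF assms] pm_ext_scale t)
qed

lemma linear_tens_lift:
  "multilinear_on_words scale B \<Longrightarrow> Vector_Spaces.linear tens_scale scale (tens_lift scale B)"
  by (simp add: Vector_Spaces.linear_iff vector_space_tens_scale vector_space_axioms
      tens_lift_add tens_lift_scale)

end

lemma multilinear_tens: "multilinear_on_words tens_scale tens"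
proof -
  have "tens (u @ (x + x') # v) = tens (u @ x # v) + tens (u @ x' # v)" for u v and x x' :: "('b, 'a) trunc_poly"
  proof -
    have "Poly_Mapping.single (u @ [x + x'] @ v) 1 - Poly_Mapping.single (u @ [x] @ v) 1
        - Poly_Mapping.single (u @ [x'] @ v) 1 \<in> pm.span tens_rels"
      by (rule pm.span_base) (unfold tens_rels_def, blast)
    then show ?thesis
      by (simp add: tens_def plus_tens_alg.abs_eq tens_alg.abs_eq_iff tens_rel_def diff_diff_eq)
  qed
  moreover have "tens (u @ tp_scale c x # v) = tens_scale c (tens (u @ x # v))" for u v and c :: 'a and x :: "('b, 'a) trunc_poly"
  proof -
    have "Poly_Mapping.single (u @ [tp_scale c x] @ v) 1 - Poly_Mapping.single (u @ [x] @ v) c \<in> pm.span tens_rels"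
      by (rule pm.span_base) (unfold tens_rels_def, blast)
    moreover have "pm_scale c (Poly_Mapping.single w 1) = Poly_Mapping.single w c" for w :: "('b, 'a) trunc_poly list" and c :: 'a
      by (rule poly_mapping_eqI) (simp add: lookup_single when_def)
    ultimately show ?thesis
      by (simp add: tens_def tens_scale.abs_eq tens_alg.abs_eq_iff tens_rel_def)
  qed
  ultimately show ?thesis
    by (simp add: multilinear_on_words_def)
qed

lemma multilinear_on_words_Cons:
  "multilinear_on_words s B \<Longrightarrow> multilinear_on_words s (\<lambda>w. B (x # w))"
  unfolding multilinear_on_words_def by (metis append_Cons)

lemma multilinear_on_wordsI:
  assumes "\<And>x x' v. B ((x + x') # v) = B (x # v) + B (x' # v)"
    and "\<And>c x v. B (tp_scale c x # v) = s c (B (x # v))"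
    and "\<And>z. multilinear_on_words s (\<lambda>w. B (z # w)) "
  shows "multilinear_on_words s B"
  unfolding multilinear_on_words_def
proof (intro conjI allI)
  fix u v x x'
  show "B (u @ (x + x') # v) = B (u @ x # v) + B (u @ x' # v)"
    using assms(1,3) by (cases u) (auto simp: multilinear_on_words_def)
next
  fix u v c x
  show "B (u @ tp_scale c x # v) = s c (B (u @ x # v))"
    using assms(2,3) by (cases u) (auto simp: multilinear_on_words_def)
qed

lemmas multilinear_tens_Cons = multilinear_on_words_Cons[OF multilinear_tens]

lemma tens_add_hd: "tens ((x + x') # w) = tens (x # w) + tens (x' # w)"
  and tens_scale_hd: "tens (tp_scale c x # w) = tens_scale c (tens (x # w))"
  using multilinear_tens unfolding multilinear_on_words_def by (metis append_Nil)+

lemma tens_cons_tens [simp]: "tens_cons x (tens w) = tens (x # w)"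
  by (simp add: tens_cons_def tens.tens_lift_tens multilinear_tens_Cons)

lemma tens_cons_add_right: "tens_cons x (t + u) = tens_cons x t + tens_cons x u"
  and tens_cons_scale_right: "tens_cons x (tens_scale c t) = tens_scale c (tens_cons x t)"
  by (simp_all add: tens_cons_def tens.tens_lift_add tens.tens_lift_scale multilinear_tens_Cons)

lemma tens_cons_0_right [simp]: "tens_cons x 0 = 0"
  using tens_cons_scale_right[of x 0 0] by simp

lemma tens_cons_diff_right: "tens_cons x (t - u) = tens_cons x t - tens_cons x u"
  using tens_cons_add_right[of x "t - u" u] by simp

lemma tens_cons_add_left: "tens_cons (x + x') t = tens_cons x t + tens_cons x' t"
  by (induction t rule: tens_alg_induct)
    (simp_all add: tens_add_hd tens_cons_add_right tens_cons_scale_right tens.scale_right_distrib)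

lemma tens_cons_scale_left: "tens_cons (tp_scale c x) t = tens_scale c (tens_cons x t)"
  by (induction t rule: tens_alg_induct)
    (simp_all add: tens_scale_hd tens_cons_add_right tens_cons_scale_right tens.scale_right_distrib
      mult.commute)

lemma tens_cons_0_left [simp]: "tens_cons 0 t = 0"
  using tens_cons_scale_left[of 0 0 t] by simp

lemma tens_cons_diff_left: "tens_cons (x - x') t = tens_cons x t - tens_cons x' t"
  using tens_cons_add_left[of "x - x'" x' t] by simp

lemma tens_power_cons: "t \<in> tens_power r \<Longrightarrow> tens_cons x t \<in> tens_power (Suc r)"
  unfolding tens_power_def
proof (induction rule: tens.span_induct_alt)
  case base
  then show ?case by (simp add: tens.span_zero)
next
  case (step c t u)
  from step(1) have "tens_cons x t \<in> tens.span (tens ` {w. length w = Suc r})"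
    by (auto intro!: tens.span_base)
  with step(2) show ?case
    by (simp add: tens_cons_add_right tens_cons_scale_right tens.span_add tens.span_scale)
qed

lemma tens_power_word: "length w = r \<Longrightarrow> tens w \<in> tens_power r"
  unfolding tens_power_def by (auto intro!: tens.span_base)

lemma subspace_tens_power: "tens.subspace (tens_power r)"
  by (simp add: tens_power_def)

lemma tens_power_Suc_induct [consumes 1, case_names zero add scale cons]:
  assumes "t \<in> tens_power (Suc r)" and "P 0" and "\<And>t u. P t \<Longrightarrow> P u \<Longrightarrow> P (t + u)"
    and "\<And>c t. P t \<Longrightarrow> P (tens_scale c t)" and "\<And>x t. t \<in> tens_power r \<Longrightarrow> P (tens_cons x t)"
  shows "P t"
  using assms(1) unfolding tens_power_def
proof (induction rule: tens.span_induct_alt)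
  case (step c t u)
  then obtain x w where "t = tens (x # w)" "length w = r"
    by (auto simp: length_Suc_conv)
  then have "P t"
    using assms(5)[OF tens_power_word, of w x] by simp
  with step(2) show ?case
    by (simp add: assms(3,4))
qed (rule assms(2))

text \<open>The map \<open>\<epsilon> \<otimes> id\<close> on tensor powers, removing the first factor.\<close>

definition tens_tl :: "('n::finite, 'k::field) tens_alg \<Rightarrow> ('n, 'k) tens_alg" where
  "tens_tl = tens_lift tens_scale (\<lambda>w. case w of [] \<Rightarrow> 0 | x # w' \<Rightarrow> tens_scale (tp_eps x) (tens w'))"

lemma multilinear_tens_tl:
  "multilinear_on_words tens_scale (\<lambda>w. case w of [] \<Rightarrow> 0 | x # w' \<Rightarrow> tens_scale (tp_eps x) (tens w'))"
  by (rule multilinear_on_wordsI)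
    (simp_all add: multilinear_tens[unfolded multilinear_on_words_def] multilinear_on_words_def
      tp_eps_add tp_eps_scale tens.scale_left_distrib tens.scale_right_distrib mult.commute)

lemma linear_tens_tl: "Vector_Spaces.linear tens_scale tens_scale tens_tl"
  unfolding tens_tl_def by (rule tens.linear_tens_lift) (rule multilinear_tens_tl)

lemma tens_tl_cons: "tens_tl (tens_cons x t) = tens_scale (tp_eps x) t"
proof -
  interpret tl: Vector_Spaces.linear tens_scale tens_scale tens_tl
    by (rule linear_tens_tl)
  show ?thesis
  proof (induction t rule: tens_alg_induct)
    case (word w)
    then show ?case
      by (simp add: tens_tl_def tens.tens_lift_tens multilinear_tens_tl)
  qed (simp_all add: tens_cons_add_right tens_cons_scale_right tl.add tl.scale
      tens.scale_right_distrib mult.commute)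
qed

text \<open>The projection onto degree one, lifted from the map that reads off the letter of a
  one-letter word and kills all other words, is a left inverse of X \<rightarrow> T(X). It lets the
  action in degree one detect the derivation part of \<psi>(a).\<close>

lemma tens_singleton_eq_0: 
  assumes "tens [x] = 0"
  shows "x = 0"
proof -
  let ?B = "\<lambda>w. case w of [v] \<Rightarrow> v | _ \<Rightarrow> (0 :: ('a, 'b) trunc_poly)"
  have B: "multilinear_on_words tp_scale ?B"
    by (rule multilinear_on_wordsI)
      (auto simp: multilinear_on_words_def split: list.splits)
  interpret l: Vector_Spaces.linear tens_scale tp_scale "tens_lift tp_scale ?B"
    by (rule tp.linear_tens_lift) (rule B)
  show ?thesis
    using tp.tens_lift_tens[OF B, of "[x]"] by (simp add: assms)
qed

section \<open>The tensor product \<open>X \<otimes> L\<close>\<close>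

lemma XL_class_eq_iff: "XL_class sL f = XL_class sL g \<longleftrightarrow> f - g \<in> module.span pm_scale (tensor_rels tp_scale sL)"
  unfolding XL_class_def by (rule coset_of_eq_iff) simp

text \<open>Identities are kept as equations between classes of formal sums, so that they can be
  rewritten summand by summand without passing through representatives.\<close>

lemma XL_class_add_cong:
  "XL_class sL f = XL_class sL f' \<Longrightarrow> XL_class sL g = XL_class sL g' \<Longrightarrow> XL_class sL (f + g) = XL_class sL (f' + g')"
  unfolding XL_class_eq_iff add_diff_add by (rule pm.span_add)

lemma XL_class_sum_cong:
  "(\<And>i. i \<in> I \<Longrightarrow> XL_class sL (f i) = XL_class sL (g i)) \<Longrightarrow> XL_class sL (sum f I) = XL_class sL (sum g I)"
  unfolding XL_class_eq_iff sum_subtractf[symmetric] by (rule pm.span_sum)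

lemma XL_class_add_left:
  "XL_class sL (Poly_Mapping.single (x + x', a) 1) = XL_class sL (Poly_Mapping.single (x, a) 1 + Poly_Mapping.single (x', a) 1)"
  unfolding XL_class_eq_iff diff_diff_eq[symmetric]
  by (rule pm.span_base) (unfold tensor_rels_def, blast)

lemma XL_class_add_right:
  "XL_class sL (Poly_Mapping.single (x, a + a') 1) = XL_class sL (Poly_Mapping.single (x, a) 1 + Poly_Mapping.single (x, a') 1)"
  unfolding XL_class_eq_iff diff_diff_eq[symmetric]
  by (rule pm.span_base) (unfold tensor_rels_def, blast)

lemma XL_class_scale_left:
  "XL_class sL (Poly_Mapping.single (tp_scale c x, a) 1) = XL_class sL (Poly_Mapping.single (x, a) c)"
  unfolding XL_class_eq_iff by (rule pm.span_base) (unfold tensor_rels_def, blast)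

lemma XL_class_scale_right:
  "XL_class sL (Poly_Mapping.single (x, sL c a) 1) = XL_class sL (Poly_Mapping.single (x, a) c)"
  unfolding XL_class_eq_iff by (rule pm.span_base) (unfold tensor_rels_def, blast)

lemma XL_class_zero_left: "XL_class sL (Poly_Mapping.single (0, a) 1) = XL_class sL 0"
  using XL_class_scale_left[of sL 0 0 a] by simp

lemma (in vector_space) XL_class_zero_right: "XL_class scale (Poly_Mapping.single (x, 0) 1) = XL_class scale 0"
  using XL_class_scale_right[of scale x 0 0] by simp

lemma XL_class_sum_left:
  "XL_class sL (Poly_Mapping.single (sum x I, a) 1) = XL_class sL (\<Sum>i\<in>I. Poly_Mapping.single (x i, a) 1)"
proof (induction I rule: infinite_finite_induct)
  case (insert i I)
  then show ?case
    using XL_class_add_cong[OF refl insert.IH] by (simp add: XL_class_add_left)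
qed (simp_all add: XL_class_zero_left)

lemma (in vector_space) XL_class_sum_right:
  "XL_class scale (Poly_Mapping.single (x, sum a I) 1) = XL_class scale (\<Sum>i\<in>I. Poly_Mapping.single (x, a i) 1)"
proof (induction I rule: infinite_finite_induct)
  case (insert i I)
  then show ?case
    using XL_class_add_cong[OF refl insert.IH] by (simp add: XL_class_add_right)
qed (simp_all add: XL_class_zero_right)

section \<open>The universal property of X \<otimes> L\<close>

definition XL_bilinear ::
  "('k::field \<Rightarrow> 'l::ab_group_add \<Rightarrow> 'l) \<Rightarrow> ('k \<Rightarrow> 'v::ab_group_add \<Rightarrow> 'v)
    \<Rightarrow> (('n::finite, 'k) trunc_poly \<Rightarrow> 'l \<Rightarrow> 'v) \<Rightarrow> bool" where
  "XL_bilinear sL s B \<longleftrightarrow>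
     (\<forall>x x' a. B (x + x') a = B x a + B x' a) \<and> (\<forall>x a a'. B x (a + a') = B x a + B x a')
   \<and> (\<forall>c x a. B (tp_scale c x) a = s c (B x a)) \<and> (\<forall>c x a. B x (sL c a) = s c (B x a))"

context vector_space
begin

lemma XL_lift_class:
  assumes "XL_bilinear sL scale B"
  shows "XL_lift scale B (XL_class sL f) = pm_ext scale (\<lambda>w. B (fst w) (snd w)) f"
proof -
  let ?R = "module.span pm_scale (tensor_rels tp_scale sL)"
  have "coset_rep (XL_class sL f) - f \<in> ?R"
    unfolding XL_class_def by (rule coset_rep_coset_of) simp
  then have "pm_ext scale (\<lambda>w. B (fst w) (snd w)) (coset_rep (XL_class sL f) - f) = 0"
    by (rule pm_ext_vanishes_on_span)
      (use assms in \<open>auto simp: tensor_rels_def XL_bilinear_def pm_ext_diff\<close>)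
  then show ?thesis
    by (simp add: XL_lift_def case_prod_unfold pm_ext_diff)
qed

lemma XL_lift_zero: "XL_bilinear sL scale B \<Longrightarrow> XL_lift scale B (XL_zero sL) = 0"
  by (simp add: XL_zero_def XL_lift_class)

lemma XL_lift_add:
  "XL_bilinear sL scale B \<Longrightarrow> XL_lift scale B (XL_add sL t u) = XL_lift scale B t + XL_lift scale B u"
  by (simp add: XL_add_def XL_lift_class pm_ext_add) (simp add: XL_lift_def case_prod_unfold)

lemma XL_lift_scale:
  "XL_bilinear sL scale B \<Longrightarrow> XL_lift scale B (XL_scale sL c t) = scale c (XL_lift scale B t)"
  by (simp add: XL_scale_def XL_lift_class pm_ext_scale) (simp add: XL_lift_def case_prod_unfold)

text \<open>Both sides use the same representatives \<open>coset_rep t\<close> and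
  \<open>coset_rep u\<close>; bilinearity of \<open>B\<close> enters once, to evaluate the outer
  lift on the class formed by \<open>XL_bracket\<close>.\<close>

lemma XL_lift_bracket:
  "XL_bilinear sL scale B \<Longrightarrow> XL_lift scale B (XL_bracket sL br t u)
     = XL_lift scale (\<lambda>x a. XL_lift scale (\<lambda>z b. B (x * z) (br a b)) u) t"
  by (simp add: XL_bracket_def XL_lift_class pm_ext_pm_ext case_prod_unfold)
    (simp add: XL_lift_def case_prod_unfold)

lemma XL_lift_der:
  "XL_bilinear sL scale B \<Longrightarrow> XL_lift scale B (XL_der sL \<delta> t) = XL_lift scale (\<lambda>x a. B (\<delta> x) a) t"
  by (simp add: XL_der_def XL_lift_class pm_ext_pm_ext case_prod_unfold)
    (simp add: XL_lift_def case_prod_unfold)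

lemma XL_lift_sum:
  "XL_bilinear sL scale B \<Longrightarrow> XL_lift scale B (XL_sum sL I x a) = (\<Sum>i\<in>I. B (x i) (a i))"
  by (simp add: XL_sum_def XL_lift_class pm_ext_sum)

lemma XL_lift_fun_add: "XL_lift scale (\<lambda>x a. B x a + C x a) t = XL_lift scale B t + XL_lift scale C t"
  by (simp add: XL_lift_def case_prod_unfold pm_ext_fun_add)

lemma XL_lift_fun_diff: "XL_lift scale (\<lambda>x a. B x a - C x a) t = XL_lift scale B t - XL_lift scale C t"
  by (simp add: XL_lift_def case_prod_unfold pm_ext_fun_diff)

lemma XL_lift_fun_scale: "XL_lift scale (\<lambda>x a. scale c (B x a)) t = scale c (XL_lift scale B t)"
  by (simp add: XL_lift_def case_prod_unfold pm_ext_fun_scale)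

lemma XL_lift_fun_0 [simp]: "XL_lift scale (\<lambda>x a. 0) t = 0"
  by (simp add: XL_lift_def case_prod_unfold)

lemma XL_lift_swap:
  "XL_lift scale (\<lambda>x a. XL_lift scale (\<lambda>z b. B x a z b) u) t
     = XL_lift scale (\<lambda>z b. XL_lift scale (\<lambda>x a. B x a z b) t) u"
  unfolding XL_lift_def case_prod_unfold by (rule pm_ext_swap)

lemma XL_lift_linear:
  "Vector_Spaces.linear scale s g \<Longrightarrow> g (XL_lift scale B t) = XL_lift s (\<lambda>x a. g (B x a)) t"
  unfolding XL_lift_def case_prod_unfold by (rule pm_ext_linear)

lemma XL_lift_in_subspace:
  assumes "subspace V" and "\<And>x a. B x a \<in> V"
  shows "XL_lift scale B t \<in> V"
  unfolding XL_lift_def pm_ext_def case_prod_unfold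
  by (intro subspace_sum subspace_scale assms)

end

section \<open>Taylor expansion in \<open>X\<close>\<close>

text \<open>Translates exponent functions, over which the theorem sums, into exponents of the
  polynomial ring; the index type is finite, so this is a bijection.\<close>

definition mono_of :: "('n::finite \<Rightarrow> nat) \<Rightarrow> 'n \<Rightarrow>\<^sub>0 nat" where
  "mono_of \<alpha> = (\<Sum>i\<in>UNIV. Poly_Mapping.single i (\<alpha> i))"

lemma lookup_mono_of [simp]: "Poly_Mapping.lookup (mono_of \<alpha>) i = \<alpha> i"
  by (simp add: mono_of_def lookup_sum lookup_single when_def)

lemma mono_of_lookup [simp]: "mono_of (Poly_Mapping.lookup a) = a"
  by (rule poly_mapping_eqI) simp

lemma inj_mono_of: "inj mono_of"
  by (metis injI lookup_mono_of ext)

lemma power_ideal_sum: "(\<And>a. a \<in> A \<Longrightarrow> f a \<in> power_ideal) \<Longrightarrow> sum f A \<in> power_ideal"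
  by (induction A rule: infinite_finite_induct) (simp_all add: power_ideal_zero power_ideal_add)

lemma single_in_power_ideal:
  fixes a :: "'n::finite \<Rightarrow>\<^sub>0 nat" and c :: "'k::field"
  assumes "CHAR('k) > 0" and "CHAR('k) \<le> Poly_Mapping.lookup a i"
  shows "Poly_Mapping.single a c \<in> power_ideal"
proof -
  let ?e = "Poly_Mapping.single i CHAR('k)"
  have "pvar i ^ CHAR('k) = (\<Sum>j\<in>UNIV. (if j = i then 1 else 0) * pvar j ^ CHAR('k) :: _ \<Rightarrow>\<^sub>0 'k)"
    by (simp add: if_distrib[where f = "\<lambda>x. x * _"] cong: if_cong)
  then have "pvar i ^ CHAR('k) \<in> (power_ideal :: (_ \<Rightarrow>\<^sub>0 'k) set)"
    using assms(1) unfolding power_ideal_def by auto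
  then have "Poly_Mapping.single (a - ?e) c * pvar i ^ CHAR('k) \<in> power_ideal"
    by (rule power_ideal_mult)
  moreover have "a - ?e + ?e = a"
    using assms(2) by (intro poly_mapping_eqI) (auto simp: lookup_add lookup_minus lookup_single when_def)
  ultimately show ?thesis
    by (simp add: pvar_power mult_single)
qed

lemma tp_var_power:
  "tp_var i ^ r = (abs_trunc_poly (Poly_Mapping.single (Poly_Mapping.single i r) 1) :: ('n::finite, 'k::field) trunc_poly)"
  unfolding pvar_power[symmetric]
  by (induction r) (simp_all add: one_trunc_poly.abs_eq tp_var.abs_eq times_trunc_poly.abs_eq)

lemma tp_var_power_eq_0:
  assumes "CHAR('k) > 0" and "r \<ge> CHAR('k)"
  shows "(tp_var i ^ r :: ('n::finite, 'k::field) trunc_poly) = 0"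
proof -
  have "(tp_var i ^ r :: ('n, 'k) trunc_poly) = abs_trunc_poly 0"
    unfolding tp_var_power abs_trunc_poly_eq_iff using assms
    by (auto intro!: single_in_power_ideal[of _ i])
  then show ?thesis
    by (simp add: zero_trunc_poly.abs_eq)
qed

definition box :: "nat \<Rightarrow> ('n::finite \<Rightarrow> nat) set" where
  "box M = {\<alpha>. \<forall>i. \<alpha> i < M}"

lemma finite_box: "finite (box M :: ('n::finite \<Rightarrow> nat) set)"
proof -
  \<comment> \<open>The clause for indices outside \<open>UNIV\<close> is vacuous; it gives the set
    the shape of functions with a default value.\<close>
  have "box M = {\<alpha> :: 'n \<Rightarrow> nat. \<forall>i. (i \<in> UNIV \<longrightarrow> \<alpha> i \<in> {..<M}) \<and> (i \<notin> UNIV \<longrightarrow> \<alpha> i = 0)}"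
    by (simp add: box_def)
  then show ?thesis
    using finite_set_of_finite_funs[of "UNIV :: 'n set" "{..<M}" 0] by simp
qed

definition multi_fact :: "('n::finite \<Rightarrow> nat) \<Rightarrow> nat" where
  "multi_fact \<alpha> = (\<Prod>i\<in>UNIV. fact (\<alpha> i))"

text \<open>None of the factors 1, ..., r is divisible by the characteristic. This makes \<alpha>!
  invertible for all exponents below p.\<close>

lemma of_nat_fact_nonzero:
  assumes "CHAR('k::field) > 0 \<Longrightarrow> r < CHAR('k)"
  shows "(of_nat (fact r) :: 'k) \<noteq> 0"
  using assms
proof (induction r)
  case (Suc r)
  have "\<not> CHAR('k) dvd Suc r"
    using Suc.prems by (cases "CHAR('k) = 0") (auto dest: dvd_imp_le)
  then have "(of_nat (Suc r) :: 'k) \<noteq> 0"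
    by (simp add: of_nat_eq_0_iff_char_dvd del: of_nat_Suc)
  moreover have "(of_nat (fact r) :: 'k) \<noteq> 0"
    using Suc by (intro Suc.IH) simp
  moreover have "(of_nat (fact (Suc r)) :: 'k) = of_nat (Suc r) * of_nat (fact r)"
    unfolding fact_Suc of_nat_mult of_nat_id ..
  ultimately show ?case
    by simp
qed simp

definition tp_mderiv :: "('n::{finite, linorder} \<Rightarrow> nat) \<Rightarrow> ('n, 'k::field) trunc_poly \<Rightarrow> ('n, 'k) trunc_poly" where
  "tp_mderiv \<alpha> = foldr (\<lambda>i. tp_pderiv i ^^ \<alpha> i) (sorted_list_of_set UNIV)"

text \<open>If \<open>b\<close> is free of the variable i, the accumulated factor (b_i + 1)...(b_i +
  r) is exactly r!.\<close>

lemma lookup_ppderiv_power: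
  assumes "Poly_Mapping.lookup b i = 0"
  shows "Poly_Mapping.lookup ((ppderiv i ^^ r) f) b = of_nat (fact r) * Poly_Mapping.lookup f (b + Poly_Mapping.single i r)"
proof (induction r arbitrary: f)
  case (Suc r)
  have "b + Poly_Mapping.single i r + Poly_Mapping.single i 1 = b + Poly_Mapping.single i (Suc r)"
    by (simp add: add.assoc flip: single_add)
  \<comment> \<open>The innermost derivative is peeled off: this changes \<open>f\<close> but keeps
    \<open>b\<close>, which has to stay free of i.\<close>
  with Suc show ?case
    using assms by (simp add: funpow_Suc_right lookup_ppderiv lookup_add algebra_simps del: funpow.simps)
qed simp

text \<open>The outermost derivative shifts \<open>b\<close> in its own variable. As the variables
  are distinct, the shifted exponent is still free of the remaining ones, hence \<open>b\<close> is
  generalised.\<close>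

lemma lookup_foldr_ppderiv:
  assumes "distinct is" and "\<And>i. i \<in> set is \<Longrightarrow> Poly_Mapping.lookup b i = 0"
  shows "Poly_Mapping.lookup (foldr (\<lambda>i. ppderiv i ^^ \<alpha> i) is f) b
    = of_nat (\<Prod>i\<in>set is. fact (\<alpha> i)) * Poly_Mapping.lookup f (b + (\<Sum>i\<in>set is. Poly_Mapping.single i (\<alpha> i)))"
  using assms
proof (induction "is" arbitrary: b)
  case (Cons j js)
  have "Poly_Mapping.lookup (b + Poly_Mapping.single j (\<alpha> j)) i = 0" if "i \<in> set js" for i
    using that Cons.prems by (auto simp: lookup_add lookup_single when_def)
  with Cons show ?case
    by (simp add: lookup_ppderiv_power add.assoc mult.assoc)
qed simp

lemma tp_eps_mderiv_abs:
  fixes f :: "('n::{finite, linorder} \<Rightarrow>\<^sub>0 nat) \<Rightarrow>\<^sub>0 'k::field"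
  shows "tp_eps (tp_mderiv \<alpha> (abs_trunc_poly f)) = of_nat (multi_fact \<alpha>) * Poly_Mapping.lookup f (mono_of \<alpha>)"
proof -
  have 1: "(tp_pderiv i ^^ r) (abs_trunc_poly g) = abs_trunc_poly ((ppderiv i ^^ r) g)"
    for i :: 'n and r and g :: "_ \<Rightarrow>\<^sub>0 'k"
    by (induction r) (simp_all add: tp_pderiv.abs_eq)
  have "foldr (\<lambda>i. tp_pderiv i ^^ \<alpha> i) is (abs_trunc_poly f) = abs_trunc_poly (foldr (\<lambda>i. ppderiv i ^^ \<alpha> i) is f)" for "is"
    by (induction "is") (simp_all add: 1)
  then have "tp_eps (tp_mderiv \<alpha> (abs_trunc_poly f))
      = Poly_Mapping.lookup (foldr (\<lambda>i. ppderiv i ^^ \<alpha> i) (sorted_list_of_set UNIV) f) 0"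
    by (simp add: tp_mderiv_def tp_eps.abs_eq)
  then show ?thesis
    by (subst (asm) lookup_foldr_ppderiv) (simp_all add: multi_fact_def mono_of_def)
qed

lemma prod_tp_var: "(\<Prod>i\<in>UNIV. tp_var i ^ \<alpha> i) = (abs_trunc_poly (Poly_Mapping.single (mono_of \<alpha>) 1) :: ('n::finite, 'k::field) trunc_poly)"
proof -
  have "finite S \<Longrightarrow> (\<Prod>i\<in>S. tp_var i ^ \<alpha> i)
      = (abs_trunc_poly (Poly_Mapping.single (\<Sum>i\<in>S. Poly_Mapping.single i (\<alpha> i)) 1) :: ('n, 'k) trunc_poly)" for S
  proof (induction S rule: finite_induct)
    case (insert i S)
    then show ?case
      by (simp add: tp_var_power times_trunc_poly.abs_eq mult_single)
  qed (simp add: one_trunc_poly.abs_eq)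
  then show ?thesis
    by (simp add: mono_of_def)
qed

text \<open>The divided power x^\<alpha> / \<alpha>!, which pairs to 1 with \<epsilon> after the
  \<alpha>-th derivative as long as \<alpha>! is nonzero in k; where \<alpha>! is 0 in k, the
  convention \<open>inverse 0 = 0\<close> makes it 0.\<close>

definition divided_mono :: "('n::finite \<Rightarrow> nat) \<Rightarrow> ('n, 'k::field) trunc_poly" where
  "divided_mono \<alpha> = tp_scale (inverse (of_nat (multi_fact \<alpha>))) (\<Prod>i\<in>UNIV. tp_var i ^ \<alpha> i)"

text \<open>Inside the box \<alpha>! is invertible and each summand is the class of one term of
  \<open>f\<close>. Outside it, a term lies in the power ideal if the characteristic is positive,
  and does not occur by the second assumption if it is 0.\<close>

lemma taylor_abs:
  fixes f :: "('n::{finite, linorder} \<Rightarrow>\<^sub>0 nat) \<Rightarrow>\<^sub>0 'k::field"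
  assumes "CHAR('k) > 0 \<Longrightarrow> M = CHAR('k)"
    and "CHAR('k) = 0 \<Longrightarrow> \<forall>a\<in>Poly_Mapping.keys f. \<forall>i. Poly_Mapping.lookup a i < M"
  shows "abs_trunc_poly f
    = (\<Sum>\<alpha>\<in>box M. tp_scale (tp_eps (tp_mderiv \<alpha> (abs_trunc_poly f))) (divided_mono \<alpha>))"
proof -
  let ?s = "\<lambda>a. Poly_Mapping.single a (Poly_Mapping.lookup f a)"
  let ?K = "Poly_Mapping.keys f" and ?B = "mono_of ` box M :: ('n \<Rightarrow>\<^sub>0 nat) set"
  have fin: "finite ?B"
    by (simp add: finite_box)
  have term_eq: "tp_scale (tp_eps (tp_mderiv \<alpha> (abs_trunc_poly f))) (divided_mono \<alpha>) = abs_trunc_poly (?s (mono_of \<alpha>))"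
    if "\<alpha> \<in> box M" for \<alpha>
  proof -
    have "(of_nat (fact (\<alpha> i)) :: 'k) \<noteq> 0" for i
      using that assms(1) by (intro of_nat_fact_nonzero) (simp add: box_def)
    then have "(of_nat (multi_fact \<alpha>) :: 'k) \<noteq> 0"
      by (simp add: multi_fact_def del: of_nat_fact)
    then show ?thesis
      by (simp add: tp_eps_mderiv_abs divided_mono_def prod_tp_var tp_scale.abs_eq mult_single field_simps)
  qed
  have abs_sum: "(\<Sum>\<alpha>\<in>A. abs_trunc_poly (g \<alpha>)) = abs_trunc_poly (\<Sum>\<alpha>\<in>A. g \<alpha>)" for A and g :: "('n \<Rightarrow> nat) \<Rightarrow> _ \<Rightarrow>\<^sub>0 'k"
    by (induction A rule: infinite_finite_induct) (simp_all add: zero_trunc_poly.abs_eq plus_trunc_poly.abs_eq)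
  have "f = (\<Sum>a\<in>?K \<union> ?B. ?s a)"
    by (subst (1) pm_sum_single, rule sum.mono_neutral_left) (auto simp: in_keys_iff fin)
  also have "\<dots> = (\<Sum>a\<in>?B. ?s a) + (\<Sum>a\<in>?K - ?B. ?s a)"
    by (subst sum.union_disjoint[symmetric]) (auto simp: fin intro: sum.cong)
  also have "(\<Sum>a\<in>?B. ?s a) = (\<Sum>\<alpha>\<in>box M. ?s (mono_of \<alpha>))"
    by (simp add: sum.reindex inj_on_subset[OF inj_mono_of])
  finally have "f - (\<Sum>\<alpha>\<in>box M. ?s (mono_of \<alpha>)) = (\<Sum>a\<in>?K - ?B. ?s a)"
    by (simp add: algebra_simps)
  also have "\<dots> \<in> power_ideal"
  proof (rule power_ideal_sum)
    fix a
    assume a: "a \<in> ?K - ?B"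
    then have "Poly_Mapping.lookup a \<notin> box M"
      by (metis DiffD2 image_eqI mono_of_lookup)
    then obtain i where i: "\<not> Poly_Mapping.lookup a i < M"
      by (auto simp: box_def)
    with a assms show "?s a \<in> power_ideal"
      by (cases "CHAR('k) = 0") (auto intro!: single_in_power_ideal[of _ i])
  qed
  finally have "abs_trunc_poly f = abs_trunc_poly (\<Sum>\<alpha>\<in>box M. ?s (mono_of \<alpha>))"
    by (simp add: abs_trunc_poly_eq_iff)
  also have "\<dots> = (\<Sum>\<alpha>\<in>box M. tp_scale (tp_eps (tp_mderiv \<alpha> (abs_trunc_poly f))) (divided_mono \<alpha>))"
    by (simp add: term_eq flip: abs_sum)
  finally show ?thesis .
qed

text \<open>A formal sum in X \<otimes> L involves finitely many polynomials, and a single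
  \<open>M\<close> has to serve all of them. In positive characteristic it is m itself.\<close>

lemma taylor_finite:
  fixes S :: "('n::{finite, linorder}, 'k::field) trunc_poly set"
  assumes "finite S" and "CHAR('k) > 0 \<Longrightarrow> m = CHAR('k)"
  obtains M where "m \<le> M" and "CHAR('k) > 0 \<longrightarrow> M = m"
    and "\<forall>x\<in>S. x = (\<Sum>\<alpha>\<in>box M. tp_scale (tp_eps (tp_mderiv \<alpha> x)) (divided_mono \<alpha>))"
proof (cases "CHAR('k) = 0")
  case False
  then have M: "m = CHAR('k)"
    using assms(2) by simp
  have "x = (\<Sum>\<alpha>\<in>box m. tp_scale (tp_eps (tp_mderiv \<alpha> x)) (divided_mono \<alpha>))" for x :: "('n, 'k) trunc_poly"
  proof -
    obtain f where "x = abs_trunc_poly f"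
      by (metis Quotient3_abs_rep Quotient3_trunc_poly)
    then show ?thesis
      using taylor_abs[of m f] False M by simp
  qed
  then show ?thesis
    using that[of m] by blast
next
  case True
  let ?r = rep_trunc_poly
  let ?E = "(\<Union>x\<in>S. \<Union>a\<in>Poly_Mapping.keys (?r x). range (Poly_Mapping.lookup a))"
  \<comment> \<open>\<open>Suc\<close>, because the bound in \<open>box\<close> is strict; m is
    inserted to obtain m \<le> M.\<close>
  define M where "M = Max (insert m (Suc ` ?E))"
  have fin: "finite (insert m (Suc ` ?E))"
    using assms(1) by simp
  have "x = (\<Sum>\<alpha>\<in>box M. tp_scale (tp_eps (tp_mderiv \<alpha> x)) (divided_mono \<alpha>))" if "x \<in> S" for x
  proof -
    have x: "x = abs_trunc_poly (?r x)"
      by (metis Quotient3_abs_rep Quotient3_trunc_poly)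
    have "Poly_Mapping.lookup a i < M" if "a \<in> Poly_Mapping.keys (?r x)" for a i
    proof -
      have "Suc (Poly_Mapping.lookup a i) \<le> M"
        unfolding M_def using that \<open>x \<in> S\<close> by (intro Max_ge fin) blast
      then show ?thesis by simp
    qed
    then show ?thesis
      using taylor_abs[of M "?r x"] True x by simp
  qed
  moreover have "m \<le> M"
    unfolding M_def by (rule Max_ge[OF fin]) simp
  ultimately show ?thesis
    using that[of M] True by simp
qed

section \<open>Taylor's formula in X \<otimes> L\<close>

lemma (in vector_space) XL_bilinear_eps:
  "XL_bilinear scale scale (\<lambda>x a. scale (tp_eps x) a)"
  unfolding XL_bilinear_def
  by (simp add: tp_eps_add tp_eps_scale scale_left_distrib scale_right_distrib mult.commute)

text \<open>Expand the X-factor of every term, move the Taylor coefficients across the tensor sign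
  into L, and exchange the two sums to collect what stands beside each divided monomial.\<close>

lemma (in vector_space) XL_taylor:
  fixes f :: "('n::{finite, linorder}, 'a, 'b) XL_formal"
  assumes "CHAR('a) > 0 \<Longrightarrow> m = CHAR('a)"
  obtains M where "m \<le> M"
    and "XL_class scale f = XL_sum scale (box M) divided_mono
      (\<lambda>\<alpha>. pm_ext scale (\<lambda>w. scale (tp_eps (tp_mderiv \<alpha> (fst w))) (snd w)) f)"
proof -
  let ?K = "Poly_Mapping.keys f" and ?l = "Poly_Mapping.lookup f"
  obtain M where M: "m \<le> M"
    and taylor: "\<forall>x\<in>fst ` ?K. x = (\<Sum>\<alpha>\<in>box M. tp_scale (tp_eps (tp_mderiv \<alpha> x)) (divided_mono \<alpha>))"
    using taylor_finite[of "fst ` ?K" m] assms by auto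
  let ?c = "\<lambda>\<alpha> w. tp_eps (tp_mderiv \<alpha> (fst w))"
  have "XL_class scale f = XL_class scale (\<Sum>w\<in>?K. Poly_Mapping.single (fst w, scale (?l w) (snd w)) 1)"
    by (subst (1) pm_sum_single, rule XL_class_sum_cong) (simp add: XL_class_scale_right)
  also have "\<dots> = XL_class scale (\<Sum>w\<in>?K. \<Sum>\<alpha>\<in>box M.
      Poly_Mapping.single (divided_mono \<alpha>, scale (?l w) (scale (?c \<alpha> w) (snd w))) 1)"
  proof (rule XL_class_sum_cong)
    fix w assume "w \<in> ?K"
    then have "fst w = (\<Sum>\<alpha>\<in>box M. tp_scale (?c \<alpha> w) (divided_mono \<alpha>))"
      using taylor by blast
    then have "XL_class scale (Poly_Mapping.single (fst w, scale (?l w) (snd w)) 1)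
        = XL_class scale (\<Sum>\<alpha>\<in>box M. Poly_Mapping.single (tp_scale (?c \<alpha> w) (divided_mono \<alpha>), scale (?l w) (snd w)) 1)"
      by (rule trans[OF arg_cong[where f = "\<lambda>x. XL_class scale (Poly_Mapping.single (x, scale (?l w) (snd w)) 1)"]
            XL_class_sum_left])
    also have "\<dots> = XL_class scale (\<Sum>\<alpha>\<in>box M.
        Poly_Mapping.single (divided_mono \<alpha>, scale (?l w) (scale (?c \<alpha> w) (snd w))) 1)"
    proof (rule XL_class_sum_cong)
      fix \<alpha>
      have "scale (?l w) (scale (?c \<alpha> w) (snd w)) = scale (?c \<alpha> w) (scale (?l w) (snd w))"
        by (simp add: mult.commute)
      then show "XL_class scale (Poly_Mapping.single (tp_scale (?c \<alpha> w) (divided_mono \<alpha>), scale (?l w) (snd w)) 1)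
        = XL_class scale (Poly_Mapping.single (divided_mono \<alpha>, scale (?l w) (scale (?c \<alpha> w) (snd w))) 1)"
        by (simp only: trans[OF XL_class_scale_left XL_class_scale_right[symmetric]])
    qed
    finally show "XL_class scale (Poly_Mapping.single (fst w, scale (?l w) (snd w)) 1)
      = XL_class scale (\<Sum>\<alpha>\<in>box M. Poly_Mapping.single (divided_mono \<alpha>, scale (?l w) (scale (?c \<alpha> w) (snd w))) 1)" .
  qed
  also have "\<dots> = XL_class scale (\<Sum>\<alpha>\<in>box M. \<Sum>w\<in>?K.
      Poly_Mapping.single (divided_mono \<alpha>, scale (?l w) (scale (?c \<alpha> w) (snd w))) 1)"
    by (subst sum.swap) (rule refl)
  also have "\<dots> = XL_sum scale (box M) divided_mono
      (\<lambda>\<alpha>. pm_ext scale (\<lambda>w. scale (tp_eps (tp_mderiv \<alpha> (fst w))) (snd w)) f)"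
    unfolding XL_sum_def pm_ext_def
    by (intro XL_class_sum_cong XL_class_sum_right[symmetric])
  finally show ?thesis
    by (rule that[OF M])
qed

section \<open>The induced action on tensor powers\<close>

locale wreath_action = lie_algebra scale br
  for scale :: "'k::field \<Rightarrow> 'l::ab_group_add \<Rightarrow> 'l" and br +
  fixes \<psi> :: "'l \<Rightarrow> ('n::finite, 'k, 'l) wreath"
  assumes hom: "wreath_hom scale br \<psi>"
begin

lemma psi_add: "\<psi> (a + b) = wreath_add scale (\<psi> a) (\<psi> b)"
  and psi_scale: "\<psi> (scale c a) = wreath_scale scale c (\<psi> a)"
  and psi_br: "\<psi> (br a b) = wreath_bracket scale br (\<psi> a) (\<psi> b)"
  using hom by (simp_all add: wreath_hom_def)

lemma snd_psi_derivation: "snd (\<psi> a) \<in> derivations"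
  and fst_psi_class: "fst (\<psi> a) \<in> range (XL_class scale)"
  using hom by (auto simp: wreath_hom_def wreath_carrier_def mem_Times_iff)

lemmas snd_psi_simps = derivationD[OF snd_psi_derivation]

lemma br_0_right [simp]: "br a 0 = 0"
  using br_scale_right[of a 0 0] by simp

lemma br_swap: "br a b = - br b a"
proof -
  have "br (a + b) (a + b) = br a b + br b a"
    by (simp add: br_add_left br_add_right br_self[of a] br_self[of b] add.commute)
  then show ?thesis
    by (simp add: br_self[of "a + b"] eq_neg_iff_add_eq_0)
qed

lemma psi_0: "\<psi> 0 = (XL_zero scale, \<lambda>x. 0)"
  using psi_scale[of 0 0] by (simp add: wreath_scale_def XL_scale_def XL_zero_def)

text \<open>The clause for one letter agrees with the general one because the empty word is sent to
  0. Inductions on words thus have a single step.\<close>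

lemma act_word_Cons:
  "act_word \<psi> a (v # w) = XL_lift tens_scale (\<lambda>z b. tens_cons (z * v) (act_word \<psi> b w)) (fst (\<psi> a))
     + tens (snd (\<psi> a) v # w)"
  by (cases w) (simp_all add: tens.XL_lift_fun_0)

lemma XL_bilinear_tens_cons:
  assumes "\<And>a b. f (a + b) = f a + f b" and "\<And>c a. f (scale c a) = tens_scale c (f a)"
  shows "XL_bilinear scale tens_scale (\<lambda>z b. tens_cons (z * v) (f b))"
  by (simp add: XL_bilinear_def assms distrib_right tp_scale_mult_left tens_cons_add_left
      tens_cons_add_right tens_cons_scale_left tens_cons_scale_right)

text \<open>Linearity for the tail makes the map in the recursion bilinear on X \<times> L; only
  then can its lift be evaluated at the sums and multiples formed in X \<otimes> L.\<close>

lemma act_word_linear: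
  "act_word \<psi> (a + b) w = act_word \<psi> a w + act_word \<psi> b w"
  "act_word \<psi> (scale c a) w = tens_scale c (act_word \<psi> a w)"
proof (induction w arbitrary: a b c)
  case (Cons v w)
  note bilin = XL_bilinear_tens_cons[of "\<lambda>b. act_word \<psi> b w" v, OF Cons]
  {
    case 1
    then show ?case
      by (simp add: act_word_Cons psi_add wreath_add_def tens.XL_lift_add[OF bilin] tens_add_hd)
  next
    case 2
    then show ?case
      by (simp add: act_word_Cons psi_scale wreath_scale_def tens.XL_lift_scale[OF bilin] tens_scale_hd
          tens.scale_right_distrib)
  }
qed simp_all

lemma multilinear_act_word: "multilinear_on_words tens_scale (act_word \<psi> a)"
  unfolding multilinear_on_words_def
proof (intro conjI allI)
  note tens_simps = multilinear_tens_Cons[unfolded multilinear_on_words_def]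
  fix u v x x'
  show "act_word \<psi> a (u @ (x + x') # v) = act_word \<psi> a (u @ x # v) + act_word \<psi> a (u @ x' # v)"
  proof (induction u arbitrary: a)
    case Nil
    then show ?case
      by (simp add: act_word_Cons snd_psi_simps tens_add_hd distrib_left tens_cons_add_left
          tens.XL_lift_fun_add)
  next
    case (Cons z u)
    then show ?case
      by (simp add: act_word_Cons tens_simps tens_cons_add_right tens.XL_lift_fun_add)
  qed
next
  note tens_simps = multilinear_tens_Cons[unfolded multilinear_on_words_def]
  fix u v c x
  show "act_word \<psi> a (u @ tp_scale c x # v) = tens_scale c (act_word \<psi> a (u @ x # v))"
  proof (induction u arbitrary: a)
    case Nil
    then show ?case
      by (simp add: act_word_Cons snd_psi_simps tens_scale_hd tp_scale_mult_right tens_cons_scale_left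
          tens.XL_lift_fun_scale tens.scale_right_distrib)
  next
    case (Cons z u)
    then show ?case
      by (simp add: act_word_Cons tens_simps tens_cons_scale_right tens.XL_lift_fun_scale
          tens.scale_right_distrib)
  qed
qed

lemma act_tens: "act \<psi> a (tens w) = act_word \<psi> a w"
  by (simp add: act_def tens.tens_lift_tens multilinear_act_word)

lemma act_add_right: "act \<psi> a (t + u) = act \<psi> a t + act \<psi> a u"
  and act_scale_right: "act \<psi> a (tens_scale c t) = tens_scale c (act \<psi> a t)"
  by (simp_all add: act_def tens.tens_lift_add tens.tens_lift_scale multilinear_act_word)

lemma linear_act: "Vector_Spaces.linear tens_scale tens_scale (act \<psi> a)"
  by (simp add: Vector_Spaces.linear_iff vector_space_tens_scale act_add_right act_scale_right)

lemma act_0_right [simp]: "act \<psi> a 0 = 0"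
  using act_scale_right[of a 0 0] by simp

lemma act_add_left: "act \<psi> (a + b) t = act \<psi> a t + act \<psi> b t"
  by (induction t rule: tens_alg_induct)
    (simp_all add: act_tens act_word_linear act_add_right act_scale_right tens.scale_right_distrib)

lemma act_scale_left: "act \<psi> (scale c a) t = tens_scale c (act \<psi> a t)"
  by (induction t rule: tens_alg_induct)
    (simp_all add: act_tens act_word_linear act_add_right act_scale_right tens.scale_right_distrib
      mult.commute)

lemma act_0_left [simp]: "act \<psi> 0 t = 0"
  using act_scale_left[of 0 0 t] by simp

lemma linear_act_left: "Vector_Spaces.linear scale tens_scale (\<lambda>a. act \<psi> a t)"
  by (simp add: Vector_Spaces.linear_iff vector_space_tens_scale vector_space_axioms act_add_left act_scale_left)

lemma XL_bilinear_act: "XL_bilinear scale tens_scale (\<lambda>z b. tens_cons (z * v) (act \<psi> b t))"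
  by (rule XL_bilinear_tens_cons) (simp_all add: act_add_left act_scale_left)

lemma act_cons:
  "act \<psi> a (tens_cons v t)
     = XL_lift tens_scale (\<lambda>z b. tens_cons (z * v) (act \<psi> b t)) (fst (\<psi> a)) + tens_cons (snd (\<psi> a) v) t"
  by (induction t rule: tens_alg_induct)
    (simp_all add: act_tens act_word_Cons tens_cons_add_right tens_cons_scale_right act_add_right
      act_scale_right tens.XL_lift_fun_add tens.XL_lift_fun_scale tens.scale_right_distrib)

text \<open>The two terms containing one derivative of \<open>v\<close> are interchanged when a and
  b are, so they cancel in the commutator; the rest is matched with the four parts of the wreath
  bracket.\<close>

lemma act_act_cons:
  defines "L \<equiv> \<lambda>B a. XL_lift tens_scale B (fst (\<psi> a))"
  shows "act \<psi> a (act \<psi> b (tens_cons v t))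
    = L (\<lambda>x a'. L (\<lambda>z b'. tens_cons (x * (z * v)) (act \<psi> a' (act \<psi> b' t))) b) a
      + L (\<lambda>z b'. tens_cons (snd (\<psi> a) z * v) (act \<psi> b' t)) b
      + L (\<lambda>z b'. tens_cons (z * snd (\<psi> a) v) (act \<psi> b' t)) b
      + L (\<lambda>z b'. tens_cons (z * snd (\<psi> b) v) (act \<psi> b' t)) a
      + tens_cons (snd (\<psi> a) (snd (\<psi> b) v)) t"
proof -
  have "act \<psi> a (L (\<lambda>z b'. tens_cons (z * v) (act \<psi> b' t)) b)
      = L (\<lambda>z b'. act \<psi> a (tens_cons (z * v) (act \<psi> b' t))) b"
    unfolding L_def by (rule tens.XL_lift_linear[OF linear_act])
  also have "\<dots> = L (\<lambda>z b'. L (\<lambda>x a'. tens_cons (x * (z * v)) (act \<psi> a' (act \<psi> b' t))) a) b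
      + L (\<lambda>z b'. tens_cons (snd (\<psi> a) z * v) (act \<psi> b' t)) b
      + L (\<lambda>z b'. tens_cons (z * snd (\<psi> a) v) (act \<psi> b' t)) b"
    by (simp add: act_cons L_def snd_psi_simps tens_cons_add_left tens.XL_lift_fun_add)
  also have "L (\<lambda>z b'. L (\<lambda>x a'. tens_cons (x * (z * v)) (act \<psi> a' (act \<psi> b' t))) a) b
      = L (\<lambda>x a'. L (\<lambda>z b'. tens_cons (x * (z * v)) (act \<psi> a' (act \<psi> b' t))) b) a"
    unfolding L_def by (rule tens.XL_lift_swap)
  finally show ?thesis
    by (simp add: act_cons act_add_right L_def)
qed

lemma act_bracket: "act \<psi> (br a b) t = act \<psi> a (act \<psi> b t) - act \<psi> b (act \<psi> a t)"
proof (induction t rule: tens_alg_induct)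
  case (word w)
  show ?case
  proof (induction w arbitrary: a b)
    case Nil
    then show ?case by (simp add: act_tens)
  next
    case (Cons v w)
    define L where "L = (\<lambda>B a. XL_lift tens_scale B (fst (\<psi> a)) :: ('n, 'k) tens_alg)"
    let ?t = "tens w"
    have "act \<psi> (br a b) (tens_cons v ?t)
        = L (\<lambda>x a'. L (\<lambda>z b'. tens_cons (x * (z * v)) (act \<psi> (br a' b') ?t)) b) a
          + L (\<lambda>z b'. tens_cons (snd (\<psi> a) z * v) (act \<psi> b' ?t)) b
          - L (\<lambda>z b'. tens_cons (snd (\<psi> b) z * v) (act \<psi> b' ?t)) a
          + tens_cons (snd (\<psi> a) (snd (\<psi> b) v) - snd (\<psi> b) (snd (\<psi> a) v)) ?t"
      by (simp add: act_cons psi_br wreath_bracket_def L_def tens.XL_lift_add[OF XL_bilinear_act]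
          tens.XL_lift_scale[OF XL_bilinear_act] tens.XL_lift_bracket[OF XL_bilinear_act]
          tens.XL_lift_der[OF XL_bilinear_act] mult.assoc del: tens_cons_tens)
    also have "L (\<lambda>x a'. L (\<lambda>z b'. tens_cons (x * (z * v)) (act \<psi> (br a' b') ?t)) b) a
        = L (\<lambda>x a'. L (\<lambda>z b'. tens_cons (x * (z * v)) (act \<psi> a' (act \<psi> b' ?t))) b) a
          - L (\<lambda>x a'. L (\<lambda>z b'. tens_cons (x * (z * v)) (act \<psi> b' (act \<psi> a' ?t))) b) a"
      by (simp add: Cons.IH L_def tens_cons_diff_right tens.XL_lift_fun_diff)
    \<comment> \<open>Commutativity of X identifies x(zv) with z(xv), so that the second double lift
      becomes the one in \<open>act_act_cons\<close> for b and a.\<close>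
    also have "L (\<lambda>x a'. L (\<lambda>z b'. tens_cons (x * (z * v)) (act \<psi> b' (act \<psi> a' ?t))) b) a
        = L (\<lambda>z b'. L (\<lambda>x a'. tens_cons (z * (x * v)) (act \<psi> b' (act \<psi> a' ?t))) a) b"
      unfolding L_def by (subst tens.XL_lift_swap) (simp only: mult.left_commute)
    finally show ?case
      unfolding tens_cons_tens[symmetric] act_act_cons
      by (simp add: tens_cons_diff_left L_def del: tens_cons_tens)
  qed
qed (simp_all add: act_add_right act_scale_right tens.scale_right_diff_distrib)

lemma act_tens_power: "t \<in> tens_power r \<Longrightarrow> act \<psi> a t \<in> tens_power r"
proof -
  have *: "act_word \<psi> a w \<in> tens_power (length w)" for a w
  proof (induction w arbitrary: a)
    case Nil
    then show ?case
      using tens.subspace_0[OF subspace_tens_power] by simp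
  next
    case (Cons v w)
    then show ?case
      unfolding act_word_Cons
      by (auto intro!: tens.subspace_add[OF subspace_tens_power] tens_power_word
          tens.XL_lift_in_subspace[OF subspace_tens_power] tens_power_cons)
  qed
  show "t \<in> tens_power r \<Longrightarrow> act \<psi> a t \<in> tens_power r"
    unfolding tens_power_def
  proof (induction rule: tens.span_induct_alt)
    case base
    then show ?case by (simp add: tens.span_zero)
  next
    case (step c t u)
    then have "act \<psi> a t \<in> tens.span (tens ` {w. length w = r})"
      using * by (auto simp: act_tens tens_power_def)
    with step show ?case
      by (simp add: act_add_right act_scale_right tens.span_add tens.span_scale)
  qed
qed

section \<open>The kernel of the action and the ideals of \<open>L\<close>\<close>

lemma ker_pi_iff: "h \<in> ker_pi \<psi> \<longleftrightarrow> snd (\<psi> h) = (\<lambda>x. 0)"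
  by (simp add: ker_pi_def)

lemma br_ker_pi: "h \<in> ker_pi \<psi> \<Longrightarrow> br a h \<in> ker_pi \<psi>"
  using snd_psi_simps(2)[of a 0 0] by (simp add: ker_pi_iff psi_br wreath_bracket_def)

lemma virt_endo_0 [simp]: "virt_endo scale \<psi> 0 = 0"
  by (simp add: virt_endo_def psi_0 XL_lift_zero[OF XL_bilinear_eps])

text \<open>The kernel is taken as the fibre over \<open>\<psi> 0\<close>; closure follows by
  comparing the homomorphism equations at the given elements with those at 0, without computing in
  the wreath product.\<close>

lemma lie_ideal_ker_psi: "lie_ideal scale br {a. \<psi> a = \<psi> 0}"
proof -
  have "\<psi> (a + b) = \<psi> 0" if "\<psi> a = \<psi> 0" "\<psi> b = \<psi> 0" for a b
    using psi_add[of a b] psi_add[of 0 0] that by simp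
  moreover have "\<psi> (scale c a) = \<psi> 0" if "\<psi> a = \<psi> 0" for c a
    using psi_scale[of c a] psi_scale[of c 0] that by simp
  moreover have "\<psi> (br b a) = \<psi> 0" if "\<psi> a = \<psi> 0" for a b
    using psi_br[of b a] psi_br[of b 0] that by simp
  ultimately show ?thesis
    by (simp add: lie_ideal_def subspace_def)
qed

lemma inj_psi_iff: "inj \<psi> \<longleftrightarrow> {a. \<psi> a = \<psi> 0} = {0}"
proof
  assume *: "{a. \<psi> a = \<psi> 0} = {0}"
  show "inj \<psi>"
  proof (rule injI)
    fix a b
    assume "\<psi> a = \<psi> b"
    then have "\<psi> (a - b) = \<psi> (b - b)"
      using psi_add[of a "- b"] psi_add[of b "- b"] by simp
    then have "a - b \<in> {0}"
      unfolding *[symmetric] by simp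
    then show "a = b" by simp
  qed
qed (auto dest: injD)

definition act_kernel :: "'l set" where
  "act_kernel = {a. \<forall>r\<ge>1. \<forall>t\<in>tens_power r. act \<psi> a t = 0}"

text \<open>A bracket acts as a commutator and every tensor power is stable under the action, so
  both terms of the commutator vanish when one of the two elements acts by zero.\<close>

lemma lie_ideal_act_kernel: "lie_ideal scale br act_kernel"
  unfolding lie_ideal_def subspace_def act_kernel_def
  by (auto simp: act_add_left act_scale_left act_bracket act_tens_power)

lemma act_kernel_ker_pi: "act_kernel \<subseteq> ker_pi \<psi>"
proof
  fix a
  assume a: "a \<in> act_kernel"
  have "snd (\<psi> a) v = 0" for v
  proof (rule tens_singleton_eq_0)
    have "act \<psi> a (tens [v]) = 0"
      using a tens_power_word[of "[v]" 1] unfolding act_kernel_def by fastforce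
    then show "tens [snd (\<psi> a) v] = 0"
      by (simp add: act_tens)
  qed
  then show "a \<in> ker_pi \<psi>"
    by (auto simp: ker_pi_iff)
qed

text \<open>Evaluate at \<open>1 \<otimes> t\<close> and apply \<open>\<epsilon> \<otimes> id\<close>: the action of \<open>h\<close> becomes the action of \<open>\<theta>(h)\<close> on \<open>t\<close>.\<close>

lemma tens_tl_act:
  assumes "h \<in> ker_pi \<psi>"
  shows "tens_tl (act \<psi> h (tens_cons 1 t)) = act \<psi> (virt_endo scale \<psi> h) t"
proof -
  have "act \<psi> (virt_endo scale \<psi> h) t = XL_lift tens_scale (\<lambda>x a. act \<psi> (scale (tp_eps x) a) t) (fst (\<psi> h))"
    unfolding virt_endo_def by (rule XL_lift_linear[OF linear_act_left])
  moreover have "tens_tl (act \<psi> h (tens_cons 1 t))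
      = XL_lift tens_scale (\<lambda>z b. tens_tl (tens_cons z (act \<psi> b t))) (fst (\<psi> h))"
    using assms by (simp add: act_cons ker_pi_iff tens.XL_lift_linear[OF linear_tens_tl])
  ultimately show ?thesis
    by (simp add: tens_tl_cons act_scale_left)
qed

text \<open>The action of \<theta>(h) in degree r is read off from that of h in degree r + 1, where
  h acts by zero.\<close>

lemma virt_endo_act_kernel: "virt_endo scale \<psi> ` act_kernel \<subseteq> act_kernel"
proof (intro image_subsetI)
  fix h
  assume h: "h \<in> act_kernel"
  interpret tl: Vector_Spaces.linear tens_scale tens_scale tens_tl
    by (rule linear_tens_tl)
  have "act \<psi> (virt_endo scale \<psi> h) t = 0" if "t \<in> tens_power r" for t r
  proof -
    have "act \<psi> h (tens_cons 1 t) = 0"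
      using h tens_power_cons[OF that, of 1] unfolding act_kernel_def
      by (metis (mono_tags, lifting) le_add1 mem_Collect_eq plus_1_eq_Suc)
    then show ?thesis
      using act_kernel_ker_pi h by (simp add: tl.zero flip: tens_tl_act[OF subsetD])
  qed
  then show "virt_endo scale \<psi> h \<in> act_kernel"
    by (simp add: act_kernel_def)
qed

end

section \<open>Derivations acting as partial derivatives\<close>

lemma tp_pderiv_add: "tp_pderiv i (x + x') = tp_pderiv i x + tp_pderiv i x'"
  by transfer (simp add: tp_rel_def ppderiv_add power_ideal_zero)

lemma tp_pderiv_scale: "tp_pderiv i (tp_scale c x) = tp_scale c (tp_pderiv i x)"
proof -
  have "ppderiv i (pm_scale c f) = pm_scale c (ppderiv i f)" for f :: "('a \<Rightarrow>\<^sub>0 nat) \<Rightarrow>\<^sub>0 'b"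
    by (rule poly_mapping_eqI) (simp add: lookup_ppderiv)
  then show ?thesis
    by transfer (simp add: tp_rel_def single_0_times power_ideal_zero)
qed

lemma tp_pderiv_var_power:
  "tp_pderiv i (tp_var i ^ Suc j) = tp_scale (of_nat (Suc j)) (tp_var i ^ j :: ('n::finite, 'k::field) trunc_poly)"
proof -
  have "Poly_Mapping.single i (Suc j) - Poly_Mapping.single i 1 = Poly_Mapping.single i j"
    by (rule poly_mapping_eqI) (simp add: lookup_minus lookup_single when_def)
  then show ?thesis
    unfolding tp_var_power by (simp add: tp_pderiv.abs_eq ppderiv_single tp_scale.abs_eq mult_single)
qed

lemma XL_bilinear_pderiv:
  "XL_bilinear sL s B \<Longrightarrow> XL_bilinear sL s (\<lambda>x. B ((tp_pderiv i ^^ r) x))"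
  by (induction r) (simp_all add: XL_bilinear_def tp_pderiv_add tp_pderiv_scale del: funpow.simps add: funpow_Suc_right)

lemma XL_bilinear_foldr_pderiv:
  "XL_bilinear sL s B \<Longrightarrow> XL_bilinear sL s (\<lambda>x. B (foldr (\<lambda>i. tp_pderiv i ^^ \<alpha> i) is x))"
proof (induction "is" arbitrary: B)
  case (Cons i "is")
  show ?case
    using Cons.IH[OF XL_bilinear_pderiv[OF Cons.prems, where i = i and r = "\<alpha> i"]] by simp
qed simp

lemma XL_bilinear_mderiv: "XL_bilinear sL s B \<Longrightarrow> XL_bilinear sL s (\<lambda>x. B (tp_mderiv \<alpha> x))"
  unfolding tp_mderiv_def by (rule XL_bilinear_foldr_pderiv)

text \<open>Commuting operators allow \<open>f i ^^ m\<close> to be moved outermost. The list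
  \<open>\<beta>\<close> records index and exponent of each occurrence, since only one occurrence of
  \<open>i\<close> gives up m of its exponent.\<close>

lemma foldr_funpow_split:
  fixes f :: "'i \<Rightarrow> 'v \<Rightarrow> 'v" and \<alpha> :: "'i \<Rightarrow> nat"
  assumes "i \<in> set is" and "m \<le> \<alpha> i" and "\<And>i j x. f i (f j x) = f j (f i x)"
  obtains \<beta> where "foldr (\<lambda>i. f i ^^ \<alpha> i) is x = (f i ^^ m) (foldr (\<lambda>(i, r). f i ^^ r) \<beta> x)"
proof -
  obtain u v where "is": "is = u @ i # v"
    using assms(1) by (meson split_list)
  have comm1: "f i ((f j ^^ r) x) = (f j ^^ r) (f i x)" for i j r x
    by (induction r) (simp_all add: assms(3)[of i j])
  have comm: "(f j ^^ s) ((f i ^^ r) x) = (f i ^^ r) ((f j ^^ s) x)" for i j r s x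
    by (induction s) (simp_all add: comm1[where i = j and j = i])
  have "foldr (\<lambda>i. f i ^^ \<alpha> i) u ((f i ^^ m) z) = (f i ^^ m) (foldr (\<lambda>i. f i ^^ \<alpha> i) u z)" for z
    by (induction u) (simp_all add: comm)
  moreover have "(f i ^^ \<alpha> i) z = (f i ^^ m) ((f i ^^ (\<alpha> i - m)) z)" for z
    using assms(2) by (metis comp_apply funpow_add le_add_diff_inverse)
  moreover have "foldr (\<lambda>i. f i ^^ \<alpha> i) js z = foldr (\<lambda>(i, r). f i ^^ r) (map (\<lambda>i. (i, \<alpha> i)) js) z" for js z
    by (induction js) simp_all
  ultimately have "foldr (\<lambda>i. f i ^^ \<alpha> i) is x
      = (f i ^^ m) (foldr (\<lambda>(i, r). f i ^^ r) (map (\<lambda>i. (i, \<alpha> i)) u @ (i, \<alpha> i - m) # map (\<lambda>i. (i, \<alpha> i)) v) x)"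
    unfolding "is" foldr_append foldr.simps comp_apply by simp
  then show ?thesis
    by (rule that)
qed

locale pderiv_wreath_action = wreath_action scale br \<psi>
  for scale :: "'k::field \<Rightarrow> 'l::ab_group_add \<Rightarrow> 'l" and br
    and \<psi> :: "'l \<Rightarrow> ('n::{finite, linorder}, 'k, 'l) wreath" +
  fixes y :: "'n \<Rightarrow> 'l" and m :: nat
  assumes psi_y: "\<psi> (y i) = (XL_zero scale, tp_pderiv i)"
    and br_y_y: "br (y i) (y j) = 0"
    and m_pos: "m > 0"
    and nilpotent: "h \<in> ker_pi \<psi> \<Longrightarrow> virt_endo scale \<psi> ((br (y i) ^^ m) h) = 0"
    and m_char: "CHAR('k) > 0 \<Longrightarrow> m = CHAR('k)"
begin

abbreviation \<theta> where "\<theta> \<equiv> virt_endo scale \<psi>"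

text \<open>By the Jacobi identity the commutator of ad(y_i) and ad(y_j) is ad([y_i, y_j]), which is
  0.\<close>

lemma br_y_commute: "br (y i) (br (y j) h) = br (y j) (br (y i) h)"
  using jacobi[of "y i" "y j" h] br_scale_right[of "y j" "-1" "br (y i) h"]
  by (simp add: br_y_y br_swap[of h])

lemma funpow_ker_pi: "h \<in> ker_pi \<psi> \<Longrightarrow> (br a ^^ r) h \<in> ker_pi \<psi>"
  by (induction r) (simp_all add: br_ker_pi)

lemma ad_monomial_ideal:
  assumes "lie_ideal scale br J" and "h \<in> J"
  shows "ad_monomial br y \<alpha> h \<in> J"
proof -
  have "(br a ^^ r) b \<in> J" if "b \<in> J" for a b r
    using that assms(1) by (induction r) (simp_all add: lie_ideal_def)
  then have "foldr (\<lambda>i. br (y i) ^^ \<alpha> i) is h \<in> J" for "is"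
    using assms(2) by (induction "is") simp_all
  then show ?thesis
    by (simp add: ad_monomial_def)
qed

lemma ad_monomial_zero [simp]: "ad_monomial br y (\<lambda>_. 0) h = h"
proof -
  have "foldr (\<lambda>i. br (y i) ^^ 0) is h = h" for "is"
    by (induction "is") simp_all
  then show ?thesis
    by (simp add: ad_monomial_def)
qed

text \<open>Some exponent is at least m, and y_i^m can be moved outermost. The other factors keep h
  inside the ideal \<open>ker_pi \<psi>\<close>, so \<open>nilpotent\<close> applies.\<close>

lemma virt_endo_ad_monomial_eq_0:
  assumes h: "h \<in> ker_pi \<psi>" and "\<alpha> \<notin> box m"
  shows "\<theta> (ad_monomial br y \<alpha> h) = 0"
proof -
  obtain i where i: "m \<le> \<alpha> i"
    using assms(2) by (auto simp: box_def not_less)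
  obtain \<beta> where "ad_monomial br y \<alpha> h = (br (y i) ^^ m) (foldr (\<lambda>(i, r). br (y i) ^^ r) \<beta> h)"
    unfolding ad_monomial_def
    using foldr_funpow_split[where i = i and \<alpha> = \<alpha> and f = "\<lambda>i. br (y i)" and x = h,
        OF _ i br_y_commute, of "sorted_list_of_set UNIV"] by auto
  moreover have "foldr (\<lambda>(i, r). br (y i) ^^ r) \<beta> h \<in> ker_pi \<psi>"
    using h by (induction \<beta>) (auto simp: funpow_ker_pi)
  ultimately show ?thesis
    by (simp add: nilpotent)
qed

end

section \<open>Brackets with the y_i as partial derivatives of \<psi>(h)\<close>

context vector_space
begin

text \<open>As \<psi>(y_i) has no part in X \<otimes> L and \<psi>(h) no derivation part, only the
  term \<partial>_i(\<psi>(h)) of the wreath bracket survives. The target of \<open>B\<close> is an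
  arbitrary vector space.\<close>

lemma XL_lift_br_y:
  assumes "pderiv_wreath_action sL br \<psi> y m" and B: "XL_bilinear sL scale B" and h: "h \<in> ker_pi \<psi>"
  shows "XL_lift scale B (fst (\<psi> (br (y i) h))) = XL_lift scale (\<lambda>x. B (tp_pderiv i x)) (fst (\<psi> h))"
proof -
  interpret P: pderiv_wreath_action sL br \<psi> y m
    by (rule assms(1))
  \<comment> \<open>The representative of the zero class may be any element of the relation span, so
    bilinearity is what makes this 0; the lifts are exchanged below to bring it inside.\<close>
  have "XL_lift scale (\<lambda>x a. B (x * z) (br a b)) (XL_zero sL) = 0" for z b
    by (rule XL_lift_zero)
      (use B in \<open>simp add: XL_bilinear_def distrib_right tp_scale_mult_left P.br_add_left P.br_scale_left\<close>)
  then have "XL_lift scale B (XL_bracket sL br (XL_zero sL) (fst (\<psi> h))) = 0"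
    by (subst XL_lift_bracket[OF B], subst XL_lift_swap) simp
  moreover have "B 0 a = 0" for a
    using B unfolding XL_bilinear_def by (metis scale_zero_left tp.scale_zero_left)
  ultimately show ?thesis
    using h by (simp add: P.psi_br P.psi_y P.ker_pi_iff wreath_bracket_def XL_lift_add[OF B]
        XL_lift_scale[OF B] XL_lift_der[OF B])
qed

text \<open>Removing the outermost bracket replaces \<open>B\<close> by \<open>B\<close> composed
  with a partial derivative, hence \<open>B\<close> is generalised in both inductions. The order of
  the factors is the same on both sides.\<close>

lemma XL_lift_ad_monomial:
  assumes P: "pderiv_wreath_action sL br \<psi> y m" and "XL_bilinear sL scale B" and h: "h \<in> ker_pi \<psi>"
  shows "XL_lift scale B (fst (\<psi> (ad_monomial br y \<alpha> h))) = XL_lift scale (\<lambda>x. B (tp_mderiv \<alpha> x)) (fst (\<psi> h))"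
proof -
  interpret P: pderiv_wreath_action sL br \<psi> y m
    by (rule P)
  have pow: "XL_lift scale B (fst (\<psi> ((br (y i) ^^ r) h))) = XL_lift scale (\<lambda>x. B ((tp_pderiv i ^^ r) x)) (fst (\<psi> h))"
    if "XL_bilinear sL scale B" "h \<in> ker_pi \<psi>" for B h i r
    using that(1)
  proof (induction r arbitrary: B)
    case (Suc r)
    have "XL_bilinear sL scale (\<lambda>x. B (tp_pderiv i x))"
      using XL_bilinear_pderiv[OF Suc.prems, where i = i and r = 1] by simp
    from Suc.IH[OF this] show ?case
      by (simp add: XL_lift_br_y[OF P Suc.prems P.funpow_ker_pi[OF that(2)]])
  qed simp
  have "foldr (\<lambda>i. br (y i) ^^ \<alpha> i) is h \<in> ker_pi \<psi> \<and>
      XL_lift scale B (fst (\<psi> (foldr (\<lambda>i. br (y i) ^^ \<alpha> i) is h)))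
        = XL_lift scale (\<lambda>x. B (foldr (\<lambda>i. tp_pderiv i ^^ \<alpha> i) is x)) (fst (\<psi> h))"
    if "XL_bilinear sL scale B" for B "is"
    using that
  proof (induction "is" arbitrary: B)
    case (Cons i "is")
    note IH = Cons.IH[OF XL_bilinear_pderiv[OF Cons.prems, where i = i and r = "\<alpha> i"]]
    then show ?case
      by (simp add: pow[OF Cons.prems] P.funpow_ker_pi)
  qed (simp add: h)
  then show ?thesis
    using assms(2) by (simp add: ad_monomial_def tp_mderiv_def)
qed

end

context pderiv_wreath_action
begin

lemma virt_endo_ad_monomial:
  assumes "h \<in> ker_pi \<psi>"
  shows "\<theta> (ad_monomial br y \<alpha> h) = XL_lift scale (\<lambda>x a. scale (tp_eps (tp_mderiv \<alpha> x)) a) (fst (\<psi> h))"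
  unfolding virt_endo_def
  by (rule XL_lift_ad_monomial[OF pderiv_wreath_action_axioms XL_bilinear_eps assms])

theorem psi_taylor:
  assumes h: "h \<in> ker_pi \<psi>"
  shows "\<psi> h = (XL_sum scale (box m) divided_mono (\<lambda>\<alpha>. \<theta> (ad_monomial br y \<alpha> h)), \<lambda>x. 0)"
proof -
  obtain f where f: "fst (\<psi> h) = XL_class scale f"
    using fst_psi_class[of h] by auto
  obtain M where M: "m \<le> M"
    and eq: "XL_class scale f = XL_sum scale (box M) divided_mono
      (\<lambda>\<alpha>. pm_ext scale (\<lambda>w. scale (tp_eps (tp_mderiv \<alpha> (fst w))) (snd w)) f)"
    by (rule XL_taylor[of m f, OF m_char])
  have "pm_ext scale (\<lambda>w. scale (tp_eps (tp_mderiv \<alpha> (fst w))) (snd w)) f = \<theta> (ad_monomial br y \<alpha> h)" for \<alpha>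
    unfolding virt_endo_ad_monomial[OF h] f
    by (rule XL_lift_class[symmetric]) (rule XL_bilinear_mderiv[OF XL_bilinear_eps])
  with eq have "fst (\<psi> h) = XL_sum scale (box M) divided_mono (\<lambda>\<alpha>. \<theta> (ad_monomial br y \<alpha> h))"
    by (simp add: f)
  \<comment> \<open>The box of size \<open>M\<close> depends on the representative \<open>f\<close>;
    its coefficients beyond \<open>box m\<close> vanish because \<theta> does on those
    ad-monomials.\<close>
  also have "\<dots> = XL_class scale (\<Sum>\<alpha>\<in>box M. if \<alpha> \<in> box m then Poly_Mapping.single (divided_mono \<alpha>, \<theta> (ad_monomial br y \<alpha> h)) 1 else 0)"
    unfolding XL_sum_def
    by (rule XL_class_sum_cong) (auto simp: virt_endo_ad_monomial_eq_0[OF h] XL_class_zero_right)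
  also have "\<dots> = XL_sum scale (box m) divided_mono (\<lambda>\<alpha>. \<theta> (ad_monomial br y \<alpha> h))"
  proof -
    have "box M \<inter> {\<alpha>. \<alpha> \<in> box m} = (box m :: ('n \<Rightarrow> nat) set)"
      using M by (auto simp: box_def intro: less_le_trans)
    then show ?thesis
      by (simp add: XL_sum_def sum.If_cases finite_box)
  qed
  finally show ?thesis
    using h by (simp add: ker_pi_iff prod_eq_iff)
qed

section \<open>Injectivity, faithfulness and finite states\<close>

lemma psi_eq_psi_0:
  assumes J: "lie_ideal scale br J" "J \<subseteq> {h \<in> ker_pi \<psi>. \<theta> h = 0}" and "h \<in> J"
  shows "\<psi> h = \<psi> 0"
proof -
  have *: "\<theta> (ad_monomial br y \<alpha> h) = 0" if "h \<in> J" for \<alpha> h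
    using ad_monomial_ideal[OF J(1) that] J(2) by auto
  \<comment> \<open>0 lies in \<open>J\<close> too and its expansion has the same vanishing
    coefficients, so the expansions of h and 0 coincide.\<close>
  have "0 \<in> J"
    using J(1) subspace_0 by (simp add: lie_ideal_def)
  then have "h \<in> ker_pi \<psi>" "0 \<in> ker_pi \<psi>"
    using J(2) assms(3) by auto
  then show ?thesis
    by (simp add: psi_taylor * assms(3) \<open>0 \<in> J\<close>)
qed

text \<open>\<open>J\<close> is closed under the ad-monomials and under \<theta>, so every
  coefficient in the expansion of \<psi>(h) lies in \<open>J\<close> and, by induction, kills the
  shorter word.\<close>

lemma act_eq_0:
  assumes J: "lie_ideal scale br J" "J \<subseteq> ker_pi \<psi>" "\<theta> ` J \<subseteq> J" and "h \<in> J"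
  shows "act \<psi> h t = 0"
proof (induction t rule: tens_alg_induct)
  case (word w)
  show ?case
    using assms(4)
  proof (induction w arbitrary: h)
    case (Cons v w)
    then have h: "h \<in> ker_pi \<psi>"
      using J(2) by auto
    have "act \<psi> (\<theta> (ad_monomial br y \<alpha> h)) (tens w) = 0" for \<alpha>
      using Cons.prems J(3) ad_monomial_ideal[OF J(1)] by (intro Cons.IH) blast
    then have "act \<psi> h (tens_cons v (tens w)) = 0"
      by (simp add: act_cons psi_taylor[OF h] tens.XL_lift_sum[OF XL_bilinear_act] del: tens_cons_tens)
    then show ?case by simp
  qed (simp add: act_tens)
qed (simp_all add: act_add_right act_scale_right)

theorem inj_psi_iff_ideals:
  "inj \<psi> \<longleftrightarrow> \<not> (\<exists>J. lie_ideal scale br J \<and> J \<noteq> {0} \<and> J \<subseteq> {h \<in> ker_pi \<psi>. \<theta> h = 0})"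
proof -
  have "{a. \<psi> a = \<psi> 0} \<subseteq> {h \<in> ker_pi \<psi>. \<theta> h = 0}"
    using virt_endo_0 by (auto simp: ker_pi_iff psi_0 virt_endo_def)
  moreover have "J \<subseteq> {0}" if "inj \<psi>" "lie_ideal scale br J" "J \<subseteq> {h \<in> ker_pi \<psi>. \<theta> h = 0}" for J
    using psi_eq_psi_0[OF that(2,3)] that(1) by (auto dest: injD)
  moreover have "0 \<in> J" if "lie_ideal scale br J" for J
    using that subspace_0 by (simp add: lie_ideal_def)
  ultimately show ?thesis
    using lie_ideal_ker_psi inj_psi_iff by (metis (no_types, lifting) subset_antisym empty_subsetI insert_subset)
qed

theorem faithful_iff_ideals:
  "inj \<psi> \<and> act_kernel = {0} \<longleftrightarrow>
     \<not> (\<exists>J. lie_ideal scale br J \<and> J \<noteq> {0} \<and> J \<subseteq> ker_pi \<psi> \<and> \<theta> ` J \<subseteq> J)"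
proof -
  have zero: "0 \<in> J" if "lie_ideal scale br J" for J
    using that subspace_0 by (simp add: lie_ideal_def)
  have "J = {0}" if "act_kernel = {0}" "lie_ideal scale br J" "J \<subseteq> ker_pi \<psi>" "\<theta> ` J \<subseteq> J" for J
  proof -
    have "J \<subseteq> act_kernel"
      using act_eq_0[OF that(2-4)] by (auto simp: act_kernel_def)
    then show ?thesis
      using that(1) zero[OF that(2)] by auto
  qed
  moreover have "act_kernel = {0}"
    if "\<not> (\<exists>J. lie_ideal scale br J \<and> J \<noteq> {0} \<and> J \<subseteq> ker_pi \<psi> \<and> \<theta> ` J \<subseteq> J)"
    using that lie_ideal_act_kernel act_kernel_ker_pi virt_endo_act_kernel by blast
  \<comment> \<open>An ideal on which \<theta> vanishes is \<theta>-invariant, so the absence of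
    invariant ideals also yields injectivity.\<close>
  moreover have "inj \<psi>"
    if none: "\<not> (\<exists>J. lie_ideal scale br J \<and> J \<noteq> {0} \<and> J \<subseteq> ker_pi \<psi> \<and> \<theta> ` J \<subseteq> J)"
    unfolding inj_psi_iff_ideals
  proof
    assume "\<exists>J. lie_ideal scale br J \<and> J \<noteq> {0} \<and> J \<subseteq> {h \<in> ker_pi \<psi>. \<theta> h = 0}"
    then obtain J where J: "lie_ideal scale br J" "J \<noteq> {0}" "J \<subseteq> {h \<in> ker_pi \<psi>. \<theta> h = 0}"
      by blast
    then have "\<theta> ` J \<subseteq> J"
      using zero[OF J(1)] by auto
    with J none show False
      by blast
  qed
  ultimately show ?thesis
    by metis
qed

text \<open>\<open>V\<close> itself is the required finite dimensional space: the coefficients of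
  \<psi>(v) stay in \<open>V\<close> and its derivation part is 0.\<close>

theorem finite_state_ker_pi:
  assumes V: "fin_dim_subspace scale V" "V \<subseteq> ker_pi \<psi>"
    and inv: "\<And>\<alpha>. \<alpha> \<in> box m \<Longrightarrow> (\<lambda>v. \<theta> (ad_monomial br y \<alpha> v)) ` V \<subseteq> V" and "h \<in> V"
  shows "finite_state scale \<psi> h"
  unfolding finite_state_def
proof (intro exI conjI subsetI)
  fix q
  assume "q \<in> \<psi> ` V"
  then obtain v where v: "v \<in> V" "q = \<psi> v"
    by blast
  let ?f = "\<Sum>\<alpha>\<in>box m. Poly_Mapping.single (divided_mono \<alpha> :: ('n, 'k) trunc_poly, \<theta> (ad_monomial br y \<alpha> v)) (1 :: 'k)"
  have "Poly_Mapping.keys ?f \<subseteq> (\<Union>\<alpha>\<in>box m. {(divided_mono \<alpha>, \<theta> (ad_monomial br y \<alpha> v))})"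
    by (rule order_trans[OF Poly_Mapping.keys_sum]) auto
  also have "\<dots> \<subseteq> UNIV \<times> V"
    using inv v(1) by blast
  finally have "XL_class scale ?f \<in> XL_sub scale V"
    unfolding XL_sub_def by blast
  then show "q \<in> XL_sub scale V \<times> derivations"
    using v V(2) by (auto simp: psi_taylor[OF subsetD] XL_sum_def zero_derivation)
qed (use assms in auto)

end

section \<open>Transitivity\<close>

context wreath_action
begin

text \<open>This is the submodule U(L) g, described by words in L so that span induction
  applies.\<close>

definition orbit_span :: "('n, 'k) tens_alg \<Rightarrow> ('n, 'k) tens_alg set" where
  "orbit_span g = tens.span (range (\<lambda>w. foldr (act \<psi>) w g))"

lemma orbit_span_act: "t \<in> orbit_span g \<Longrightarrow> act \<psi> a t \<in> orbit_span g"
  unfolding orbit_span_def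
proof (induction rule: tens.span_induct_alt)
  case base
  then show ?case by (simp add: tens.span_zero)
next
  case (step c t u)
  from step(1) obtain w where "act \<psi> a t = foldr (act \<psi>) (a # w) g"
    by auto
  then have "act \<psi> a t \<in> tens.span (range (\<lambda>w. foldr (act \<psi>) w g))"
    by (metis rangeI tens.span_base)
  with step show ?case
    by (simp add: act_add_right act_scale_right tens.span_add tens.span_scale)
qed

lemma orbit_span_subset: "g \<in> tens_power r \<Longrightarrow> orbit_span g \<subseteq> tens_power r"
  unfolding orbit_span_def
proof (rule tens.span_minimal[OF _ subspace_tens_power])
  assume "g \<in> tens_power r"
  then have "foldr (act \<psi>) w g \<in> tens_power r" for w
    by (induction w) (simp_all add: act_tens_power)
  then show "range (\<lambda>w. foldr (act \<psi>) w g) \<subseteq> tens_power r"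
    by blast
qed

lemma orbit_span_eq_pm_ext:
  assumes "t \<in> orbit_span g"
  obtains f where "t = pm_ext tens_scale (\<lambda>w. foldr (act \<psi>) w g) f"
proof -
  have "\<exists>f. t = pm_ext tens_scale (\<lambda>w. foldr (act \<psi>) w g) f"
    using assms unfolding orbit_span_def
  proof (induction rule: tens.span_induct_alt)
    case base
    then show ?case
      using tens.pm_ext_0 by metis
  next
    case (step c t u)
    then obtain w f where "t = foldr (act \<psi>) w g" "u = pm_ext tens_scale (\<lambda>w. foldr (act \<psi>) w g) f"
      by auto
    then have "tens_scale c t + u = pm_ext tens_scale (\<lambda>w. foldr (act \<psi>) w g) (Poly_Mapping.single w c + f)"
      by (simp add: tens.pm_ext_add tens.pm_ext_single)
    then show ?case by blast
  qed
  then show ?thesis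
    using that by blast
qed

text \<open>The relations sit between arbitrary words u and v: the letters in the middle are handled
  by linearity in L and \<open>act_bracket\<close>, the prefix u by additivity of its
  action.\<close>

lemma env_act_coset:
  "env_act tens_scale (act \<psi>) (coset_of (module.span pm_scale (env_rels scale br)) f) g
     = pm_ext tens_scale (\<lambda>w. foldr (act \<psi>) w g) f"
proof -
  let ?R = "module.span pm_scale (env_rels scale br)"
  let ?E = "pm_ext tens_scale (\<lambda>w. foldr (act \<psi>) w g)"
  have add: "foldr (act \<psi>) u (t + t') = foldr (act \<psi>) u t + foldr (act \<psi>) u t'" for u t t'
    by (induction u) (simp_all add: act_add_right)
  have scale: "foldr (act \<psi>) u (tens_scale c t) = tens_scale c (foldr (act \<psi>) u t)" for u c t
    by (induction u) (simp_all add: act_scale_right)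
  have diff: "foldr (act \<psi>) u (t - t') = foldr (act \<psi>) u t - foldr (act \<psi>) u t'" for u t t'
    using add[of u "t - t'" t'] by simp
  have "?E (coset_rep (coset_of ?R f) - f) = 0"
  proof (rule tens.pm_ext_vanishes_on_span)
    show "coset_rep (coset_of ?R f) - f \<in> ?R"
      by (rule coset_rep_coset_of) simp
    show "?E q = 0" if "q \<in> env_rels scale br" for q
      using that unfolding env_rels_def
      by (auto simp: tens.pm_ext_diff tens.pm_ext_single act_add_left act_scale_left act_bracket
          add scale diff)
  qed
  then show ?thesis
    by (simp add: env_act_def tens.pm_ext_diff)
qed

lemma cyclic_module_tens_power:
  assumes "g \<in> tens_power r" and "tens_power r \<subseteq> orbit_span g"
  shows "cyclic_module scale br tens_scale (act \<psi>) (tens_power r) g"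
proof -
  have "(\<lambda>u. env_act tens_scale (act \<psi>) u g) ` env_alg scale br
      = range (pm_ext tens_scale (\<lambda>w. foldr (act \<psi>) w g))"
    by (simp add: env_alg_def image_image env_act_coset)
  also have "\<dots> = orbit_span g"
  proof
    show "range (pm_ext tens_scale (\<lambda>w. foldr (act \<psi>) w g)) \<subseteq> orbit_span g"
      unfolding orbit_span_def pm_ext_def
      by (intro image_subsetI tens.span_sum tens.span_scale tens.span_base rangeI)
    show "orbit_span g \<subseteq> range (pm_ext tens_scale (\<lambda>w. foldr (act \<psi>) w g))"
      using orbit_span_eq_pm_ext by blast
  qed
  also have "\<dots> = tens_power r"
    using assms orbit_span_subset by blast
  finally show ?thesis
    by (simp add: cyclic_module_def assms(1))
qed

end

section \<open>One variable in characteristic p\<close>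

locale one_variable_action = pderiv_wreath_action scale br \<psi> y m
  for scale :: "'k::field \<Rightarrow> 'l::ab_group_add \<Rightarrow> 'l" and br
    and \<psi> :: "'l \<Rightarrow> ('n::{finite, linorder}, 'k, 'l) wreath" and y m +
  fixes i :: 'n
  assumes char_pos: "CHAR('k) > 0" and UNIV_eq: "UNIV = {i}"
    and theta_onto: "virt_endo scale \<psi> ` ker_pi \<psi> = UNIV"
begin

abbreviation top_tens :: "nat \<Rightarrow> ('n, 'k) tens_alg" where
  "top_tens r \<equiv> tens (replicate r (tp_var i ^ (m - 1)))"

lemma act_y_cons: "act \<psi> (y i) (tens_cons v t) = tens_cons (tp_pderiv i v) t"
  by (simp add: act_cons psi_y tens.XL_lift_zero[OF XL_bilinear_act])

lemma divided_mono_eq: "divided_mono \<alpha> = tp_scale (inverse (of_nat (multi_fact \<alpha>))) (tp_var i ^ \<alpha> i)"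
  by (simp add: divided_mono_def UNIV_eq)

text \<open>Since \<open>x\<^sup>p = 0\<close>, only the term \<open>1 \<otimes> \<theta>(h)\<close> of \<open>\<psi>(h)\<close> acts on \<open>x\<^bsup>p-1\<^esup> \<otimes> t\<close>.\<close>

lemma act_ker_pi_top:
  assumes h: "h \<in> ker_pi \<psi>"
  shows "act \<psi> h (tens_cons (tp_var i ^ (m - 1)) t) = tens_cons (tp_var i ^ (m - 1)) (act \<psi> (\<theta> h) t)"
proof -
  let ?x = "tp_var i ^ (m - 1) :: ('n, 'k) trunc_poly"
  have "act \<psi> h (tens_cons ?x t)
      = (\<Sum>\<alpha>\<in>box m. tens_cons (divided_mono \<alpha> * ?x) (act \<psi> (\<theta> (ad_monomial br y \<alpha> h)) t))"
    by (simp add: act_cons psi_taylor[OF h] tens.XL_lift_sum[OF XL_bilinear_act])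
  also have "\<dots> = (\<Sum>\<alpha>\<in>{\<lambda>_. 0}. tens_cons (divided_mono \<alpha> * ?x) (act \<psi> (\<theta> (ad_monomial br y \<alpha> h)) t))"
  proof (rule sum.mono_neutral_right)
    show "\<forall>\<alpha>\<in>box m - {\<lambda>_. 0}. tens_cons (divided_mono \<alpha> * ?x) (act \<psi> (\<theta> (ad_monomial br y \<alpha> h)) t) = 0"
    proof
      fix \<alpha> :: "'n \<Rightarrow> nat"
      assume "\<alpha> \<in> box m - {\<lambda>_. 0}"
      then have "\<alpha> i \<noteq> 0"
        using UNIV_eq by (auto simp: fun_eq_iff)
      then have "(tp_var i ^ (\<alpha> i + (m - 1)) :: ('n, 'k) trunc_poly) = 0"
        using m_char char_pos by (intro tp_var_power_eq_0) auto
      then have "divided_mono \<alpha> * ?x = 0"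
        by (simp add: divided_mono_eq tp_scale_mult_left flip: power_add)
      then show "tens_cons (divided_mono \<alpha> * ?x) (act \<psi> (\<theta> (ad_monomial br y \<alpha> h)) t) = 0"
        by simp
    qed
  qed (simp add: finite_box, simp add: box_def m_pos)
  also have "\<dots> = tens_cons ?x (act \<psi> (\<theta> h) t)"
    by (simp add: divided_mono_eq multi_fact_def)
  finally show ?thesis .
qed

text \<open>Each letter a of a word is \<theta>(h) for some h in H, and h acts on x^(p-1) \<otimes>
  t as a does on t. A word acting on the generator of degree r is thus lifted letter by letter to
  degree r + 1.\<close>

lemma orbit_span_top_cons:
  assumes "t \<in> orbit_span (top_tens r)"
  shows "tens_cons (tp_var i ^ (m - 1)) t \<in> orbit_span (top_tens (Suc r))"
  using assms unfolding orbit_span_def[of "top_tens r"]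
proof (induction rule: tens.span_induct_alt)
  case base
  then show ?case by (simp add: orbit_span_def tens.span_zero)
next
  case (step c t u)
  then obtain w where t: "t = foldr (act \<psi>) w (top_tens r)"
    by auto
  have "tens_cons (tp_var i ^ (m - 1)) t \<in> orbit_span (top_tens (Suc r))"
    unfolding t
  proof (induction w)
    case Nil
    have "foldr (act \<psi>) [] (top_tens (Suc r)) \<in> orbit_span (top_tens (Suc r))"
      unfolding orbit_span_def by (intro tens.span_base rangeI)
    then show ?case by simp
  next
    case (Cons a w)
    obtain h where "h \<in> ker_pi \<psi>" "\<theta> h = a"
      using theta_onto by (metis UNIV_I imageE)
    then have "tens_cons (tp_var i ^ (m - 1)) (foldr (act \<psi>) (a # w) (top_tens r))
        = act \<psi> h (tens_cons (tp_var i ^ (m - 1)) (foldr (act \<psi>) w (top_tens r)))"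
      by (simp add: act_ker_pi_top del: One_nat_def)
    then show ?case
      using orbit_span_act[OF Cons] by simp
  qed
  with step(2) show ?case
    by (simp add: tens_cons_add_right tens_cons_scale_right orbit_span_def tens.span_add tens.span_scale)
qed

text \<open>Differentiating the first factor takes x^(p-1) \<otimes> t to x^j \<otimes> t for every
  j < p, up to the invertible scalar (p-1)(p-2)...(j+1); these powers span X.\<close>

lemma orbit_span_cons:
  assumes "t \<in> orbit_span (top_tens r)"
  shows "tens_cons v t \<in> orbit_span (top_tens (Suc r))"
proof -
  have sub: "tens.subspace (orbit_span (top_tens (Suc r)))"
    by (simp add: orbit_span_def)
  have power: "tens_cons (tp_var i ^ (m - 1 - j)) t \<in> orbit_span (top_tens (Suc r))" if "j \<le> m - 1" for j
    using that
  proof (induction j)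
    case 0
    then show ?case
      using orbit_span_top_cons[OF assms] by simp
  next
    case (Suc j)
    \<comment> \<open>\<open>d\<close> is the exponent after one more differentiation; d + 1 lies
      between 1 and p - 1 and is therefore invertible in k.\<close>
    define d where "d = m - 1 - Suc j"
    have d: "m - 1 - j = Suc d"
      using Suc.prems by (simp add: d_def)
    have "\<not> CHAR('k) dvd Suc d"
      using m_char[OF char_pos] d m_pos by (auto dest!: dvd_imp_le)
    then have nz: "(of_nat (Suc d) :: 'k) \<noteq> 0"
      by (simp add: of_nat_eq_0_iff_char_dvd del: of_nat_Suc)
    have "act \<psi> (y i) (tens_cons (tp_var i ^ Suc d) t) \<in> orbit_span (top_tens (Suc r))"
      using Suc by (intro orbit_span_act) (simp only: d Suc_leD)
    then have "tens_scale (of_nat (Suc d)) (tens_cons (tp_var i ^ d) t) \<in> orbit_span (top_tens (Suc r))"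
      by (simp only: act_y_cons tp_pderiv_var_power tens_cons_scale_left)
    from tens.subspace_scale[OF sub this, of "inverse (of_nat (Suc d))"]
    have "tens_cons (tp_var i ^ d) t \<in> orbit_span (top_tens (Suc r))"
      using nz by (simp del: of_nat_Suc)
    then show ?case
      by (simp only: d_def)
  qed
  obtain M where "m \<le> M" "CHAR('k) > 0 \<longrightarrow> M = m"
    and "\<forall>x\<in>{v}. x = (\<Sum>\<alpha>\<in>box M. tp_scale (tp_eps (tp_mderiv \<alpha> x)) (divided_mono \<alpha>))"
    using taylor_finite[of "{v}" m] m_char by auto
  then have v: "v = (\<Sum>\<alpha>\<in>box m. tp_scale (tp_eps (tp_mderiv \<alpha> v)) (divided_mono \<alpha>))"
    using char_pos by simp
  have cons_sum: "tens_cons (\<Sum>\<alpha>\<in>A. x \<alpha>) t = (\<Sum>\<alpha>\<in>A. tens_cons (x \<alpha>) t)"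
    for A and x :: "('n \<Rightarrow> nat) \<Rightarrow> _"
    by (induction A rule: infinite_finite_induct) (simp_all add: tens_cons_add_left)
  show ?thesis
  proof (subst v, unfold cons_sum divided_mono_eq tens_cons_scale_left,
      intro tens.subspace_sum[OF sub] tens.subspace_scale[OF sub])
    fix \<alpha> :: "'n \<Rightarrow> nat"
    assume "\<alpha> \<in> box m"
    then have "\<alpha> i \<le> m - 1"
      using m_pos by (simp add: box_def less_Suc_eq_le[symmetric])
    then show "tens_cons (tp_var i ^ \<alpha> i) t \<in> orbit_span (top_tens (Suc r))"
      using power[of "m - 1 - \<alpha> i"] by (simp only: diff_le_self diff_diff_cancel)
  qed
qed

lemma tens_power_subset_orbit: "tens_power r \<subseteq> orbit_span (top_tens r)"
proof (induction r)
  case 0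
  have "foldr (act \<psi>) [] (tens []) \<in> orbit_span (tens [])"
    unfolding orbit_span_def by (intro tens.span_base rangeI)
  then show ?case
    unfolding tens_power_def by (intro tens.span_minimal) (auto simp: orbit_span_def)
next
  case (Suc r)
  have sub: "tens.subspace (orbit_span (top_tens (Suc r)))"
    by (simp add: orbit_span_def)
  show ?case
  proof
    fix t :: "('n, 'k) tens_alg"
    assume "t \<in> tens_power (Suc r)"
    then show "t \<in> orbit_span (top_tens (Suc r))"
    proof (induction rule: tens_power_Suc_induct)
      case (cons x t)
      then show ?case
        using Suc.IH by (intro orbit_span_cons) blast
    qed (fact tens.subspace_0[OF sub] tens.subspace_add[OF sub] tens.subspace_scale[OF sub])+
  qed
qed

theorem transitive: "transitive_action scale br \<psi>"
  unfolding transitive_action_def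
proof (intro allI impI)
  fix r :: nat and j :: 'n
  have "j = i"
    using UNIV_eq by auto
  then show "cyclic_module scale br tens_scale (act \<psi>) (tens_power r)
      (tens (replicate r (tp_var j ^ (CHAR('k) - 1))))"
    using cyclic_module_tens_power[OF _ tens_power_subset_orbit] m_char[OF char_pos]
    by (simp add: tens_power_word)
qed

text \<open>\<partial>x/\<partial>x = 1 shows that the image is not inside X \<otimes> L. Were it
  inside Der X, then \<theta> would be 0, but y_i is one of its values.\<close>

theorem proper: "y i \<noteq> 0 \<Longrightarrow> wreath_proper scale \<psi>"
  unfolding wreath_proper_def
proof (intro conjI notI)
  assume "\<forall>a. snd (\<psi> a) = (\<lambda>x. 0)"
  then have "tp_pderiv i (tp_var i ^ Suc 0) = (0 :: ('n, 'k) trunc_poly)"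
    using psi_y[of i] by (metis snd_conv)
  then show False
    unfolding tp_pderiv_var_power by simp
next
  assume "y i \<noteq> 0" and "\<forall>a. fst (\<psi> a) = XL_zero scale"
  moreover obtain h where "\<theta> h = y i"
    using theta_onto by (metis UNIV_I imageE)
  ultimately show False
    by (simp add: virt_endo_def XL_lift_zero[OF XL_bilinear_eps])
qed

end

text \<open>The predicate \<open>transitive_self_similar\<close> includes injectivity of \<psi>, the
  subject of b). In e) cyclicity of the tensor powers is asserted outright, and the full predicate
  whenever \<psi> is a monomorphism; properness is derived.\<close>

theorem theoremA:
  fixes sL :: "'k::field \<Rightarrow> 'l::ab_group_add \<Rightarrow> 'l"
    and br :: "'l \<Rightarrow> 'l \<Rightarrow> 'l"
    and \<psi> :: "'l \<Rightarrow> ('n::{finite, linorder}, 'k, 'l) wreath"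
    and \<theta> :: "'l \<Rightarrow> 'l"
    and H L0 A :: "'l set"
    and y :: "'n \<Rightarrow> 'l"
    and m :: nat
  assumes "lie_algebra sL br"
    and "wreath_hom sL br \<psi>"
    and "H = ker_pi \<psi>"
    and "\<theta> = virt_endo sL \<psi>"
    and "lie_semidirect sL br H L0"
    and "lie_subalgebra sL br A" and "A \<subseteq> L0" and "\<forall>a\<in>A. \<forall>b\<in>A. br a b = 0"
    and "inj y" and "\<not> module.dependent sL (range y)" and "module.span sL (range y) = A"
    and "\<forall>i. \<psi> (y i) = (XL_zero sL, tp_pderiv i)"
    and "m > 0"
    and "\<forall>i. \<forall>h\<in>H. \<theta> ((br (y i) ^^ m) h) = 0"
    and "CHAR('k) > 0 \<longrightarrow> m = CHAR('k)"
  shows "(\<forall>h\<in>H. \<psi> h =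
             (XL_sum sL {\<alpha>. \<forall>i. \<alpha> i \<le> m - 1}
                (\<lambda>\<alpha>. tp_scale (inverse (of_nat (\<Prod>i\<in>UNIV. fact (\<alpha> i)))) (\<Prod>i\<in>UNIV. tp_var i ^ \<alpha> i))
                (\<lambda>\<alpha>. \<theta> (ad_monomial br y \<alpha> h)),
              \<lambda>x. 0))
    \<and> (wreath_mono sL br \<psi> \<longleftrightarrow>
         \<not> (\<exists>J. lie_ideal sL br J \<and> J \<noteq> {0} \<and> J \<subseteq> {h \<in> H. \<theta> h = 0}))
    \<and> (faithful_self_similar sL br \<psi> \<longleftrightarrow>
         \<not> (\<exists>J. lie_ideal sL br J \<and> J \<noteq> {0} \<and> J \<subseteq> H \<and> \<theta> ` J \<subseteq> J))
    \<and> (\<forall>h\<in>H.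
         (\<exists>V. fin_dim_subspace sL V \<and> V \<subseteq> H \<and> h \<in> V
              \<and> (\<forall>\<alpha>. (\<forall>i. \<alpha> i \<le> m - 1) \<longrightarrow> (\<lambda>v. \<theta> (ad_monomial br y \<alpha> v)) ` V \<subseteq> V))
         \<longrightarrow> finite_state sL \<psi> h)
    \<and> (CARD('n) = 1 \<and> CHAR('k) > 0 \<and> \<theta> ` H = UNIV \<longrightarrow>
         transitive_action sL br \<psi> \<and> (wreath_mono sL br \<psi> \<longrightarrow> transitive_self_similar sL br \<psi>))"
proof -
  interpret lie_algebra sL br
    by (rule assms(1))
  have "y i \<in> A" for i
    using assms(11) span_base by blast
  then interpret P: pderiv_wreath_action sL br \<psi> y m
    using assms by unfold_locales auto
  \<comment> \<open>Subtraction is truncated: m > 0 makes \<alpha> i \<le> m - 1 the same as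
    \<alpha> i < m.\<close>
  have box: "{\<alpha> :: 'n \<Rightarrow> nat. \<forall>i. \<alpha> i \<le> m - 1} = box m"
    using assms(13) by (auto simp: box_def Suc_le_eq[symmetric] le_diff_conv2)
  note H = assms(3) and th = assms(4)
  have mono: "wreath_mono sL br \<psi> \<longleftrightarrow> inj \<psi>"
    by (simp add: wreath_mono_def assms(2))
  have ker: "(\<Inter>r\<in>{1..}. {a. \<forall>t\<in>tens_power r. act \<psi> a t = 0}) = P.act_kernel"
    by (auto simp: P.act_kernel_def)
  have "\<psi> h = (XL_sum sL {\<alpha>. \<forall>i. \<alpha> i \<le> m - 1}
                (\<lambda>\<alpha>. tp_scale (inverse (of_nat (\<Prod>i\<in>UNIV. fact (\<alpha> i)))) (\<Prod>i\<in>UNIV. tp_var i ^ \<alpha> i))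
                (\<lambda>\<alpha>. \<theta> (ad_monomial br y \<alpha> h)),
              \<lambda>x. 0)" if "h \<in> H" for h
    using P.psi_taylor[of h] that unfolding box H th divided_mono_def multi_fact_def by blast
  moreover have "finite_state sL \<psi> h"
    if V: "\<exists>V. fin_dim_subspace sL V \<and> V \<subseteq> H \<and> h \<in> V
          \<and> (\<forall>\<alpha>. (\<forall>i. \<alpha> i \<le> m - 1) \<longrightarrow> (\<lambda>v. \<theta> (ad_monomial br y \<alpha> v)) ` V \<subseteq> V)" for h
  proof -
    obtain V where V: "fin_dim_subspace sL V" "V \<subseteq> H" "h \<in> V"
      and inv: "\<forall>\<alpha>. (\<forall>i. \<alpha> i \<le> m - 1) \<longrightarrow> (\<lambda>v. \<theta> (ad_monomial br y \<alpha> v)) ` V \<subseteq> V"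
      using V by blast
    show ?thesis
    proof (rule P.finite_state_ker_pi[OF V(1) V(2)[unfolded H] _ V(3)])
      fix \<alpha> :: "'n \<Rightarrow> nat"
      assume "\<alpha> \<in> box m"
      then have "\<forall>i. \<alpha> i \<le> m - 1"
        unfolding box[symmetric] by (rule CollectD)
      with inv show "(\<lambda>v. virt_endo sL \<psi> (ad_monomial br y \<alpha> v)) ` V \<subseteq> V"
        unfolding th by blast
    qed
  qed
  moreover have "transitive_action sL br \<psi> \<and> (wreath_mono sL br \<psi> \<longrightarrow> transitive_self_similar sL br \<psi>)"
    if e: "CARD('n) = 1 \<and> CHAR('k) > 0 \<and> \<theta> ` H = UNIV"
  proof -
    obtain i :: 'n where "UNIV = {i}"
      using e by (auto simp: card_1_singleton_iff)
    then interpret Q: one_variable_action sL br \<psi> y m i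
      using e H th by unfold_locales auto
    have "y i \<noteq> 0"
      using assms(10) dependent_zero by (metis rangeI)
    then show ?thesis
      using Q.transitive Q.proper by (simp add: transitive_self_similar_def self_similar_def)
  qed
  moreover have "wreath_mono sL br \<psi> \<longleftrightarrow>
      \<not> (\<exists>J. lie_ideal sL br J \<and> J \<noteq> {0} \<and> J \<subseteq> {h \<in> H. \<theta> h = 0})"
    unfolding mono H th by (rule P.inj_psi_iff_ideals)
  moreover have "faithful_self_similar sL br \<psi> \<longleftrightarrow>
      \<not> (\<exists>J. lie_ideal sL br J \<and> J \<noteq> {0} \<and> J \<subseteq> H \<and> \<theta> ` J \<subseteq> J)"
    unfolding faithful_self_similar_def mono ker H th by (rule P.faithful_iff_ideals)
  ultimately show ?thesis
    by (intro conjI ballI impI) (assumption | (elim conjE, simp))+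
qed

end
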